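(* Let $w \in \mathfrak{S}_n$ with $n\ge 1$. Then: (i) $\mathrm{dp}(w) = \ell_S(w)$ if and only if $w$ avoids the pattern $321$; and (ii) $\ell_T(w) = \mathrm{dp}(w)$ if and only if $w$ avoids both of the patterns $321$ and $3412$. In particular, the number of $w\in\mathfrak{S}_n$ with $\mathrm{dp}(w) = \ell_S(w)$ is the Catalan number $\frac{1}{n+1}\binom{2n}{n}$, and the number of $w\in\mathfrak{S}_n$ with $\ell_T(w) = \mathrm{dp}(w)$ is the Fibonacci number $F_{2n-1}$.
   Context: $\mathfrak{S}_n$ is the group of permutations of $\{1,\dots,n\}$. For $1\le i<j\le n$, $t_{ij}$ denotes the transposition interchanging $i$ and $j$; its depth is $j-i$. The length $\ell_S(w)$ is the minimal number of factors in an expression of $w$ as a product of adjacent transpositions $s_i=t_{i,i+1}$; the reflection length $\ell_T(w)$ is the minimal number of factors in an expression of $w$ as a product of arbitrary transpositions. The depth of $w$ is $$\mathrm{dp}(w)=\min\Big\{\sum_{r=1}^k (j_r-i_r) : k\ge 0,\ w=t_{i_1j_1}\cdots t_{i_kj_k},\ i_r<j_r\Big\}.$$ For $p\in\mathfrak{S}_k$, the permutation $w$ contains the pattern $p$ if there are indices $i_1<\cdots<i_k$ such that $w(i_1)\cdots w(i_k)$ is in the same relative order as $p(1)\cdots p(k)$; otherwise $w$ avoids $p$. The Fibonacci numbers are $F_0=0$, $F_1=1$, $F_{m}=F_{m-1}+F_{m-2}$. *)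

theory Defs
  imports "HOL-Combinatorics.Permutations" "HOL-Number_Theory.Fib"
begin

text \<open>
  The symmetric group on \<open>{1..n}\<close> is the set of functions \<open>w\<close> with \<open>w permutes {1..n}\<close>.
  A factorisation is the list of its pairs \<open>(i, j)\<close>; \<open>apply_transps\<close> composes the corresponding
  transpositions in the order listed.
\<close>

definition transposition_factorizations :: "nat \<Rightarrow> (nat \<Rightarrow> nat) \<Rightarrow> (nat \<times> nat) list set" where
  "transposition_factorizations n w =
     {ts. (\<forall>(i, j) \<in> set ts. 1 \<le> i \<and> i < j \<and> j \<le> n) \<and> apply_transps ts = w}"

text \<open>
  The minima below are infima in \<open>nat\<close>. They are attained whenever \<open>w permutes {1..n}\<close>, since
  \<open>w\<close> is then a product of adjacent transpositions; they carry no meaning for other \<open>w\<close>.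
\<close>

definition coxeter_length :: "nat \<Rightarrow> (nat \<Rightarrow> nat) \<Rightarrow> nat" where
  "coxeter_length n w =
     Inf {length ts | ts. ts \<in> transposition_factorizations n w \<and>
                          (\<forall>(i, j) \<in> set ts. j = i + 1)}"

definition reflection_length :: "nat \<Rightarrow> (nat \<Rightarrow> nat) \<Rightarrow> nat" where
  "reflection_length n w = Inf {length ts | ts. ts \<in> transposition_factorizations n w}"

definition depth :: "nat \<Rightarrow> (nat \<Rightarrow> nat) \<Rightarrow> nat" where
  "depth n w = Inf {\<Sum>(i, j)\<leftarrow>ts. j - i | ts. ts \<in> transposition_factorizations n w}"

text \<open>
  The pattern \<open>p\<close> is given in one-line notation, as the list \<open>[p 1, \<dots>, p k]\<close>; its positions are
  therefore counted from \<open>0\<close>, whereas positions of \<open>w\<close> lie in \<open>{1..n}\<close>.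
\<close>

definition contains_pattern :: "nat \<Rightarrow> (nat \<Rightarrow> nat) \<Rightarrow> nat list \<Rightarrow> bool" where
  "contains_pattern n w p \<longleftrightarrow>
     (\<exists>f. strict_mono_on {..<length p} f \<and> f ` {..<length p} \<subseteq> {1..n} \<and>
          (\<forall>a < length p. \<forall>b < length p. w (f a) < w (f b) \<longleftrightarrow> p ! a < p ! b))"

abbreviation avoids_pattern :: "nat \<Rightarrow> (nat \<Rightarrow> nat) \<Rightarrow> nat list \<Rightarrow> bool" where
  "avoids_pattern n w p \<equiv> \<not> contains_pattern n w p"

end

theory Submission
  imports Defs
begin

text \<open>
  Let \<open>c\<^sub>k(w)\<close> be the number of \<open>a \<le> k\<close> with \<open>w(a) > k\<close>. Multiplying \<open>w\<close> on the right by \<open>t\<^sub>i\<^sub>j\<close> changes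
  \<open>c\<^sub>k\<close> by at most one, and only for \<open>i \<le> k < j\<close>; hence \<open>dp(w) \<ge> \<Sum>\<^sub>k c\<^sub>k(w)\<close>. If \<open>w \<noteq> id\<close>, there are \<open>i < j\<close> with
  \<open>w(i) \<ge> j\<close>, \<open>w(j) \<le> i\<close> and only fixed points in between, and then \<open>t\<^sub>i\<^sub>j\<close> lowers all these \<open>c\<^sub>k\<close>, so that
  \<open>dp(w) = \<Sum>\<^sub>k c\<^sub>k(w)\<close>.

  A fixed point in between would be the middle of a 321-pattern, so for a 321-avoiding \<open>w\<close> the step is
  adjacent; conversely adjacent steps that raise the sum preserve 321-avoidance. This gives (i).

  For (ii), a factorization with as many factors as the depth consists of adjacent transpositions. If one
  of them occurs twice, conjugating the factors in between by it saves two factors. If all are distinct,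
  counting the invariant subsets of \<open>w\<close> (there are \<open>2\<close> to the number of cycles) shows that the factorization
  is shortest. Distinctness means \<open>c\<^sub>k \<le> 1\<close> for all \<open>k\<close>, which for 321-avoiding \<open>w\<close> is 3412-avoidance.

  Both counts come from deleting the largest value. The number \<open>g(n, d)\<close> of 321-avoiding permutations
  increasing from position \<open>d\<close> on obeys the ballot recurrence \<open>g(n + 1, d + 1) = g(n + 1, d) + g(n, d + 1)\<close>. For
  permutations avoiding both patterns, inserting \<open>n + 1\<close> at \<open>p \<le> n\<close> is allowed exactly if all positions
  above \<open>p\<close> are fixed, which yields \<open>B(n + 1) = B(n) + B(1) + \<dots> + B(n)\<close>.
\<close>

section \<open>Crossing numbers and depth\<close>

definition crossings :: "(nat \<Rightarrow> nat) \<Rightarrow> nat \<Rightarrow> nat" where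
  "crossings w k = card {a. a \<le> k \<and> k < w a}"

text \<open>For a permutation of {1..n} this is the sum of w(a) - a over the positions with w(a) >
  a, which is half the total displacement.\<close>

definition total_crossings :: "nat \<Rightarrow> (nat \<Rightarrow> nat) \<Rightarrow> nat" where
  "total_crossings n w = (\<Sum>k<n. crossings w k)"

lemma finite_crossing_set [simp]: "finite {a::nat. a \<le> k \<and> P a}"
  by (rule finite_subset[of _ "{..k}"]) auto

lemma crossings_id [simp]: "crossings id k = 0"
  by (auto simp: crossings_def)

section \<open>Effect of one transposition on the crossing numbers\<close>

lemma crossings_transpose_outside:
  assumes "i < j" "\<not> (i \<le> k \<and> k < j)"
  shows "crossings (w \<circ> Transposition.transpose i j) k = crossings w k"
proof -
  let ?t = "Transposition.transpose i j"
  have le: "?t a \<le> k \<longleftrightarrow> a \<le> k" for a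
    using assms by (auto simp: Transposition.transpose_def)
  have "{a. a \<le> k \<and> k < w (?t a)} = ?t ` {a. a \<le> k \<and> k < w a}"
  proof (intro set_eqI iffI)
    fix x assume "x \<in> {a. a \<le> k \<and> k < w (?t a)}"
    then show "x \<in> ?t ` {a. a \<le> k \<and> k < w a}"
      by (intro image_eqI[of _ _ "?t x"]) (auto simp: le)
  qed (auto simp: le)
  then show ?thesis
    by (simp add: crossings_def card_image)
qed

text \<open>For i \<le> k < j only the position i can newly join the counted set, because j lies
  above k. For other k the transposition maps {..k} to itself and merely permutes that set.\<close>

lemma crossings_transpose_le:
  assumes "i < j"
  shows "crossings (w \<circ> Transposition.transpose i j) k \<le> crossings w k + of_bool (i \<le> k \<and> k < j)"
proof (cases "i \<le> k \<and> k < j")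
  case True
  have "{a. a \<le> k \<and> k < w (Transposition.transpose i j a)} \<subseteq> insert i {a. a \<le> k \<and> k < w a}"
    using True by (auto simp: Transposition.transpose_def split: if_splits)
  then have "crossings (w \<circ> Transposition.transpose i j) k \<le> card (insert i {a. a \<le> k \<and> k < w a})"
    unfolding crossings_def o_apply by (intro card_mono) auto
  then show ?thesis
    using True by (simp add: crossings_def card_insert_if split: if_splits)
qed (use assms in \<open>simp add: crossings_transpose_outside\<close>)

text \<open>Before the swap i is counted at every level i \<le> k < j, since w(i) \<ge> j.
  Afterwards it carries w(j) \<le> i and is not, while the other positions up to k are
  untouched.\<close>

lemma crossings_transpose_drop:
  assumes "i < j" "j \<le> w i" "w j \<le> i"
  shows "crossings w k = crossings (w \<circ> Transposition.transpose i j) k + of_bool (i \<le> k \<and> k < j)"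
proof (cases "i \<le> k \<and> k < j")
  case True
  have "{a. a \<le> k \<and> k < w a} = insert i {a. a \<le> k \<and> k < w (Transposition.transpose i j a)}"
    using True assms by (auto simp: Transposition.transpose_def split: if_splits)
  moreover have "i \<notin> {a. a \<le> k \<and> k < w (Transposition.transpose i j a)}"
    using True assms by auto
  ultimately show ?thesis
    using True by (simp add: crossings_def)
qed (use assms in \<open>simp add: crossings_transpose_outside\<close>)

text \<open>Membership in the two counted sets can differ at position i only, so a strict increase
  means that i enters.\<close>

lemma crossings_transpose_adjacent_strict:
  assumes "crossings u i < crossings (u \<circ> Transposition.transpose i (i + 1)) i"
  shows "u i \<le> i" "i < u (i + 1)"
proof -
  let ?A = "{a. a \<le> i \<and> i < u a}"
  let ?B = "{a. a \<le> i \<and> i < u (Transposition.transpose i (i + 1) a)}"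
  have less: "card ?A < card ?B"
    using assms by (simp add: crossings_def)
  have off: "a \<in> ?A \<longleftrightarrow> a \<in> ?B" if "a \<noteq> i" for a
    using that by (auto simp: Transposition.transpose_def)
  have "\<not> ?B \<subseteq> ?A"
    using less card_mono[of ?A ?B] by auto
  then obtain x where x: "x \<in> ?B" "x \<notin> ?A"
    by blast
  then have "x = i"
    using off by metis
  with x have "i \<in> ?B" "i \<notin> ?A"
    by simp_all
  then show "u i \<le> i" "i < u (i + 1)"
    by auto
qed

lemma crossings_apply_transps_le:
  assumes "\<forall>(i, j) \<in> set ts. i < j"
  shows "crossings (apply_transps ts) k \<le> length (filter (\<lambda>(i, j). i \<le> k \<and> k < j) ts)"
  using assms
proof (induction ts rule: rev_induct)
  case (snoc x ts)
  obtain i j where x: "x = (i, j)" by (cases x)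
  have "i < j"
    using snoc.prems x by auto
  then show ?case
    using snoc crossings_transpose_le[of i j "apply_transps ts" k]
    by (auto simp: x o_def)
qed simp

text \<open>Double counting: a pair (i, j) straddles exactly j - i levels.\<close>

lemma sum_length_filter_straddle:
  assumes "\<forall>(i, j) \<in> set ts. i < j \<and> j \<le> n"
  shows "(\<Sum>k<n. length (filter (\<lambda>(i, j). i \<le> k \<and> k < j) ts)) = (\<Sum>(i, j)\<leftarrow>ts. j - i)"
  using assms
proof (induction ts)
  case (Cons x ts)
  obtain i j where x: "x = (i, j)" by (cases x)
  have eq: "{k. k < n \<and> i \<le> k \<and> k < j} = {i..<j}"
    using Cons.prems by (auto simp: x)
  have "(\<Sum>k<n. length (filter (\<lambda>(i, j). i \<le> k \<and> k < j) (x # ts)))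
      = (\<Sum>k<n. of_bool (i \<le> k \<and> k < j) + length (filter (\<lambda>(i, j). i \<le> k \<and> k < j) ts))"
    by (intro sum.cong) (auto simp: x)
  also have "\<dots> = card {k. k < n \<and> i \<le> k \<and> k < j} + (\<Sum>(i, j)\<leftarrow>ts. j - i)"
    using Cons by (simp add: sum.distrib Int_def)
  finally show ?case
    by (simp add: x eq)
qed simp

lemma total_crossings_apply_transps_le:
  assumes "\<forall>(i, j) \<in> set ts. i < j \<and> j \<le> n"
  shows "total_crossings n (apply_transps ts) \<le> (\<Sum>(i, j)\<leftarrow>ts. j - i)"
proof -
  have "total_crossings n (apply_transps ts)
      \<le> (\<Sum>k<n. length (filter (\<lambda>(i, j). i \<le> k \<and> k < j) ts))"
    unfolding total_crossings_def
    by (intro sum_mono crossings_apply_transps_le) (use assms in auto)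
  then show ?thesis
    using sum_length_filter_straddle[OF assms] by simp
qed

lemma total_crossings_transpose_drop:
  assumes "i < j" "j \<le> w i" "w j \<le> i" "j \<le> n"
  shows "total_crossings n w = total_crossings n (w \<circ> Transposition.transpose i j) + (j - i)"
proof -
  have eq: "{k. k < n \<and> i \<le> k \<and> k < j} = {i..<j}"
    using assms by auto
  have "total_crossings n w
      = (\<Sum>k<n. crossings (w \<circ> Transposition.transpose i j) k + of_bool (i \<le> k \<and> k < j))"
    unfolding total_crossings_def
    by (intro sum.cong refl crossings_transpose_drop assms)
  also have "\<dots> = total_crossings n (w \<circ> Transposition.transpose i j) + card {k. k < n \<and> i \<le> k \<and> k < j}"
    by (simp add: sum.distrib total_crossings_def Int_def)
  finally show ?thesis
    by (simp add: eq)
qed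

text \<open>Take for j the first position with w(j) < j and for i the last non-fixed point before j.
  The fixed points in between occupy their own values, which forces w(i) past them to at least j and
  w(j) down to at most i.\<close>

lemma exists_straddling_pair:
  assumes w: "w permutes {1..n::nat}" and "w \<noteq> id"
  obtains i j where "1 \<le> i" "i < j" "j \<le> n" "j \<le> w i" "w j \<le> i"
    "\<And>k. i < k \<Longrightarrow> k < j \<Longrightarrow> w k = k"
proof -
  have inj: "w x = w y \<longleftrightarrow> x = y" for x y
    using permutes_inj[OF w] by (auto dest: injD)
  have fixed: "w x = x" if "x = 0 \<or> n < x" for x
    using permutes_not_in[OF w] that by auto
  have "\<exists>j. w j < j"
  proof (rule ccontr)
    assume no: "\<nexists>j. w j < j"
    \<comment> \<open>Downward induction from n: if x < w x, then w x is already known to be fixed,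
      against injectivity.\<close>
    have "w x = x" for x
    proof (induction "Suc n - x" arbitrary: x rule: less_induct)
      case less
      show ?case
      proof (rule ccontr)
        assume "w x \<noteq> x"
        then have "x < w x" "x \<le> n"
          using no[simplified, rule_format, of x] fixed[of x] by linarith+
        then have "w (w x) = w x"
          by (intro less) auto
        then show False
          using inj \<open>w x \<noteq> x\<close> by simp
      qed
    qed
    then show False
      using \<open>w \<noteq> id\<close> by auto
  qed
  then obtain j where j: "w j < j" and least: "\<And>x. x < j \<Longrightarrow> x \<le> w x"
    using exists_least_iff[of "\<lambda>j. w j < j"] by (metis not_less)
  define I where "I = {i. i < j \<and> w i \<noteq> i}"
  have fin: "finite I"
    by (rule finite_subset[of _ "{..j}"]) (auto simp: I_def)
  \<comment> \<open>So \<open>I\<close> is nonempty, with \<open>w j\<close> as a member, and its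
    maximum exists.\<close>
  have "w (w j) \<noteq> w j"
    using inj j by auto
  then have "w j \<in> I"
    using j by (auto simp: I_def)
  define i where "i = Max I"
  have "i \<in> I"
    using Max_in[OF fin] \<open>w j \<in> I\<close> by (auto simp: i_def)
  have btw: "w k = k" if "i < k" "k < j" for k
    using Max_ge[OF fin, of k] that by (fastforce simp: i_def I_def)
  have ij: "i < j" "i < w i"
    using \<open>i \<in> I\<close> least[of i] by (auto simp: I_def)
  have "w j \<le> i"
    using btw[of "w j"] inj j by (metis not_less less_irrefl)
  moreover have "j \<le> w i"
    using btw[of "w i"] inj ij by (metis not_less less_irrefl)
  moreover have "1 \<le> i" "j \<le> n"
    using fixed[of i] fixed[of j] ij j by (cases i; force)+
  ultimately show ?thesis
    using that btw ij by blast
qed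

lemma transposition_factorizations_snoc:
  assumes "ts \<in> transposition_factorizations n (w \<circ> Transposition.transpose i j)"
    and "1 \<le> i" "i < j" "j \<le> n"
  shows "ts @ [(i, j)] \<in> transposition_factorizations n w"
  using assms by (auto simp: transposition_factorizations_def comp_assoc)

lemma transposition_factorizationsD:
  assumes "ts \<in> transposition_factorizations n w"
  shows "\<And>i j. (i, j) \<in> set ts \<Longrightarrow> 1 \<le> i \<and> i < j \<and> j \<le> n" "apply_transps ts = w"
  using assms by (auto simp: transposition_factorizations_def)

lemma permutes_comp_transpose:
  assumes "w permutes {1..n::nat}" "1 \<le> i" "i < j" "j \<le> n"
  shows "w \<circ> Transposition.transpose i j permutes {1..n}"
  using assms by (intro permutes_compose permutes_swap_id) auto

lemma factorization_of_depth_total_crossings: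
  assumes "w permutes {1..n}"
  shows "\<exists>ts \<in> transposition_factorizations n w. (\<Sum>(i, j)\<leftarrow>ts. j - i) = total_crossings n w"
  using assms
proof (induction "total_crossings n w" arbitrary: w rule: less_induct)
  case less
  show ?case
  proof (cases "w = id")
    case True
    then show ?thesis
      by (intro bexI[of _ "[]"]) (auto simp: transposition_factorizations_def total_crossings_def)
  next
    case False
    then obtain i j where ij: "1 \<le> i" "i < j" "j \<le> n" "j \<le> w i" "w j \<le> i"
      using exists_straddling_pair less.prems by metis
    let ?u = "w \<circ> Transposition.transpose i j"
    have drop: "total_crossings n w = total_crossings n ?u + (j - i)"
      using ij by (intro total_crossings_transpose_drop)
    then have "total_crossings n ?u < total_crossings n w"
      using ij by simp
    then obtain ts where "ts \<in> transposition_factorizations n ?u"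
        "(\<Sum>(i, j)\<leftarrow>ts. j - i) = total_crossings n ?u"
      using less.hyps permutes_comp_transpose[OF less.prems] ij by metis
    then show ?thesis
      using drop ij by (intro bexI[of _ "ts @ [(i, j)]"]) (auto intro: transposition_factorizations_snoc)
  qed
qed

lemma Inf_nat_eqI:
  fixes m :: nat
  assumes "m \<in> A" "\<And>x. x \<in> A \<Longrightarrow> m \<le> x"
  shows "Inf A = m"
  using assms by (intro antisym cInf_lower cInf_greatest) auto

lemma depth_eq_total_crossings:
  assumes "w permutes {1..n}"
  shows "depth n w = total_crossings n w"
  unfolding depth_def
proof (rule Inf_nat_eqI)
  show "total_crossings n w \<in> {\<Sum>(i, j)\<leftarrow>ts. j - i | ts. ts \<in> transposition_factorizations n w}"
    using factorization_of_depth_total_crossings[OF assms] by force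
next
  fix x assume "x \<in> {\<Sum>(i, j)\<leftarrow>ts. j - i | ts. ts \<in> transposition_factorizations n w}"
  then obtain ts where ts: "x = (\<Sum>(i, j)\<leftarrow>ts. j - i)" "ts \<in> transposition_factorizations n w"
    by auto
  have "\<forall>(i, j) \<in> set ts. i < j \<and> j \<le> n"
    using transposition_factorizationsD(1)[OF ts(2)] by auto
  from total_crossings_apply_transps_le[OF this] show "total_crossings n w \<le> x"
    using transposition_factorizationsD(2)[OF ts(2)] ts(1) by simp
qed

section \<open>Avoidance of 321 and Coxeter length\<close>

text \<open>Positions range over all naturals, which keeps n out of the insertion arguments.
  Inversions of a permutation of {1..n} lie in {1..n} anyway, by
  \<open>permutes_inversionD\<close>.\<close>

definition avoids_321 :: "(nat \<Rightarrow> nat) \<Rightarrow> bool" where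
  "avoids_321 w \<longleftrightarrow> (\<forall>a b c. a < b \<longrightarrow> b < c \<longrightarrow> \<not> (w c < w b \<and> w b < w a))"

definition avoids_3412 :: "(nat \<Rightarrow> nat) \<Rightarrow> bool" where
  "avoids_3412 w \<longleftrightarrow>
     (\<forall>a b c d. a < b \<longrightarrow> b < c \<longrightarrow> c < d \<longrightarrow> \<not> (w c < w d \<and> w d < w a \<and> w a < w b))"

lemma avoids_321_id [simp]: "avoids_321 id"
  by (auto simp: avoids_321_def)

section \<open>Adjacent swaps that preserve 321-avoidance\<close>

lemma avoids_321_transpose_descent:
  assumes "avoids_321 w" "w (i + 1) < w i"
  shows "avoids_321 (w \<circ> Transposition.transpose i (i + 1))"
  unfolding avoids_321_def
proof (intro allI impI notI)
  fix a b c :: nat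
  let ?t = "Transposition.transpose i (i + 1)"
  assume "a < b" "b < c" and inv: "(w \<circ> ?t) c < (w \<circ> ?t) b \<and> (w \<circ> ?t) b < (w \<circ> ?t) a"
  \<comment> \<open>The swap reverses the order of the pair (i, i + 1) only, and that pair is no
    inversion after a descent has been undone. Hence every inversion, and with it every 321, comes
    from one of \<open>w\<close>.\<close>
  have mono: "?t x < ?t y" if "x < y" "(w \<circ> ?t) y < (w \<circ> ?t) x" for x y
    using that assms(2) by (auto simp: Transposition.transpose_def split: if_splits)
  have "?t a < ?t b" "?t b < ?t c"
    using mono inv \<open>a < b\<close> \<open>b < c\<close> by auto
  then show False
    using assms(1) inv unfolding avoids_321_def by auto
qed

text \<open>Pigeonhole: otherwise the i + 1 positions consisting of c and those below i would all
  take values below u(i) \<le> i.\<close>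

lemma inversion_left:
  fixes u :: "nat \<Rightarrow> nat"
  assumes "inj u" "u i \<le> i" "i < c" "u c < u i"
  shows "\<exists>a<i. u i < u a"
proof (rule ccontr)
  assume no: "\<not> (\<exists>a<i. u i < u a)"
  have "u x < u i" if "x < i" for x
    using no that injD[OF assms(1), of x i] by (metis not_less_iff_gr_or_eq)
  then have "u ` insert c {..<i} \<subseteq> {..<u i}"
    using assms by auto
  then have "card (insert c {..<i}) \<le> card {..<u i}"
    by (intro card_inj_on_le[of u]) (use inj_on_subset[OF assms(1) subset_UNIV] in auto)
  then show False
    using assms by simp
qed

text \<open>Pigeonhole: otherwise all u(j) \<ge> j values below u(j) would come from the j - 1
  positions below j other than a.\<close>

lemma inversion_right:
  fixes u :: "nat \<Rightarrow> nat"
  assumes "bij u" "j \<le> u j" "a < j" "u j < u a"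
  shows "\<exists>c>j. u c < u j"
proof (rule ccontr)
  assume no: "\<not> (\<exists>c>j. u c < u j)"
  have "{..<u j} \<subseteq> u ` ({..<j} - {a})"
  proof
    fix y assume "y \<in> {..<u j}"
    moreover obtain x where "y = u x"
      using assms(1) by (meson bij_pointE)
    moreover have "\<not> j < x"
      using no calculation by auto
    ultimately show "y \<in> u ` ({..<j} - {a})"
      using assms by (cases "x = j") auto
  qed
  then have "card {..<u j} \<le> card ({..<j} - {a})"
    by (intro surj_card_le) auto
  then show False
    using assms by simp
qed

text \<open>A new 321 must use the new inversion at (i, i + 1), as its first two or its last two
  entries. By the counting lemmas above, the entry of the pair that also forms an inversion of
  \<open>u\<close> with the third entry has a further inversion on its other side, and so was
  already the middle of a 321 in \<open>u\<close>.\<close>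

lemma avoids_321_transpose_ascent:
  assumes u: "bij u" "avoids_321 u" "u i \<le> i" "i < u (i + 1)"
  shows "avoids_321 (u \<circ> Transposition.transpose i (i + 1))"
  unfolding avoids_321_def
proof (intro allI impI notI)
  fix a b c :: nat
  let ?t = "Transposition.transpose i (i + 1)"
  assume abc: "a < b" "b < c" and inv: "(u \<circ> ?t) c < (u \<circ> ?t) b \<and> (u \<circ> ?t) b < (u \<circ> ?t) a"
  have no: "\<not> (u z < u y \<and> u y < u x)" if "x < y" "y < z" for x y z
    using u(2) that unfolding avoids_321_def by blast
  have mono: "?t x < ?t y" if "x < y" "\<not> (x = i \<and> y = i + 1)" for x y
    using that by (auto simp: Transposition.transpose_def)
  consider "a = i" "b = i + 1" | "b = i" "c = i + 1" | "?t a < ?t b" "?t b < ?t c"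
    using mono abc by blast
  then show False
  proof cases
    case 1
    then have "i < c" "u c < u i"
      using abc inv by (auto simp: Transposition.transpose_def split: if_splits)
    then show False
      using inversion_left[of u i c] no u(1,3) bij_is_inj by blast
  next
    case 2
    then have "a < i + 1" "u (i + 1) < u a"
      using abc inv by (auto simp: Transposition.transpose_def split: if_splits)
    then show False
      using inversion_right[of u "i + 1" a] no u(1,4)
      by (metis Suc_eq_plus1 Suc_leI)
  next
    case 3
    then show False
      using no inv by auto
  qed
qed

lemma adjacent_factorization_if_avoids_321:
  assumes "w permutes {1..n}" "avoids_321 w"
  shows "\<exists>ts \<in> transposition_factorizations n w.
           (\<forall>(i, j) \<in> set ts. j = i + 1) \<and> length ts = total_crossings n w"
  using assms
proof (induction "total_crossings n w" arbitrary: w rule: less_induct)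
  case less
  show ?case
  proof (cases "w = id")
    case True
    then show ?thesis
      by (intro bexI[of _ "[]"]) (auto simp: transposition_factorizations_def total_crossings_def)
  next
    case False
    then obtain i j where ij: "1 \<le> i" "i < j" "j \<le> n" "j \<le> w i" "w j \<le> i"
        "\<And>k. i < k \<Longrightarrow> k < j \<Longrightarrow> w k = k"
      using exists_straddling_pair less.prems(1) by metis
    have "j = i + 1"
    proof (rule ccontr)
      assume "j \<noteq> i + 1"
      then have "i < i + 1" "i + 1 < j" "w j < w (i + 1)" "w (i + 1) < w i"
        using ij(2,4,5) ij(6)[of "i + 1"] by auto
      then show False
        using less.prems(2) unfolding avoids_321_def by blast
    qed
    let ?u = "w \<circ> Transposition.transpose i j"
    have drop: "total_crossings n w = total_crossings n ?u + (j - i)"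
      using ij by (intro total_crossings_transpose_drop)
    have "total_crossings n ?u < total_crossings n w"
      using ij drop by simp
    moreover have "?u permutes {1..n}"
      using permutes_comp_transpose less.prems(1) ij by blast
    moreover have "avoids_321 ?u"
      using avoids_321_transpose_descent[of w i] less.prems(2) ij \<open>j = i + 1\<close> by auto
    ultimately obtain ts where "ts \<in> transposition_factorizations n ?u"
        "\<forall>(i, j) \<in> set ts. j = i + 1" "length ts = total_crossings n ?u"
      using less.hyps by blast
    then show ?thesis
      using drop ij \<open>j = i + 1\<close>
      by (intro bexI[of _ "ts @ [(i, j)]"]) (auto intro: transposition_factorizations_snoc)
  qed
qed

lemma sum_list_depths_adjacent:
  fixes ts :: "(nat \<times> nat) list"
  assumes "\<forall>(i, j) \<in> set ts. j = i + 1"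
  shows "(\<Sum>(i, j)\<leftarrow>ts. j - i) = length ts"
  using assms by (induction ts) auto

text \<open>Each adjacent factor raises the total by at most one. If the length equals the total,
  every prefix is tight as well and every factor raises its own level, which is the situation of
  \<open>avoids_321_transpose_ascent\<close>.\<close>

lemma avoids_321_if_adjacent_factorization:
  assumes "\<forall>(i, j) \<in> set ts. 1 \<le> i \<and> j = i + 1 \<and> j \<le> n"
    and "length ts = total_crossings n (apply_transps ts)"
  shows "avoids_321 (apply_transps ts)"
  using assms
proof (induction ts rule: rev_induct)
  case (snoc x ts)
  obtain i where x: "x = (i, i + 1)"
    using snoc.prems(1) by (cases x) auto
  let ?u = "apply_transps ts"
  let ?w = "?u \<circ> Transposition.transpose i (i + 1)"
  have adj: "\<forall>(i, j) \<in> set ts. 1 \<le> i \<and> j = i + 1 \<and> j \<le> n" and i: "i < n"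
    using snoc.prems(1) by (auto simp: x)
  have le: "crossings ?w k \<le> crossings ?u k + of_bool (i \<le> k \<and> k < i + 1)" for k
    by (intro crossings_transpose_le) simp
  have bound: "total_crossings n ?u \<le> length ts"
    using total_crossings_apply_transps_le[of ts n] sum_list_depths_adjacent[of ts] adj by fastforce
  have w: "total_crossings n ?w = length ts + 1"
    using snoc.prems(2) by (simp add: x o_def)
  \<comment> \<open>Level i is split off because the last factor cannot raise any other
    level.\<close>
  have split: "total_crossings n v = crossings v i + (\<Sum>k\<in>{..<n} - {i}. crossings v k)" for v
    unfolding total_crossings_def using i by (intro sum.remove) auto
  have "(\<Sum>k\<in>{..<n} - {i}. crossings ?w k) \<le> (\<Sum>k\<in>{..<n} - {i}. crossings ?u k)"
    by (intro sum_mono order.trans[OF le]) auto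
  then have "crossings ?u i < crossings ?w i"
    using split[of ?u] split[of ?w] bound w by linarith
  moreover have "avoids_321 ?u"
    using snoc.IH adj bound w split[of ?u] split[of ?w]
      \<open>(\<Sum>k\<in>{..<n} - {i}. crossings ?w k) \<le> (\<Sum>k\<in>{..<n} - {i}. crossings ?u k)\<close> le[of i] by simp
  moreover have "bij ?u"
    by (simp add: permutation_bijective)
  ultimately show ?case
    using avoids_321_transpose_ascent crossings_transpose_adjacent_strict
    by (simp add: x o_def)
qed simp

lemma apply_adj_transps_conv_apply_transps:
  "apply_adj_transps xs = apply_transps (map (\<lambda>i. (i, i + 1)) xs)"
  by (induction xs) simp_all

lemma set_adj_transp_seq: "set (adj_transp_seq a b) \<subseteq> {a..<b}"
proof (induction a b rule: adj_transp_seq.induct)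
  case (1 a b)
  then show ?case
    by (subst adj_transp_seq.simps) (auto dest!: subsetD[of _ "{Suc a..<b}"])
qed

lemma adjacent_factorization_exists:
  assumes "w permutes {1..n}"
  shows "\<exists>ts \<in> transposition_factorizations n w. \<forall>(i, j) \<in> set ts. j = i + 1"
proof -
  obtain xs where xs: "\<forall>(a, b) \<in> set xs. a \<noteq> b \<and> a \<in> {1..n} \<and> b \<in> {1..n}" "apply_transps xs = w"
    using permutes_from_transpositions[OF assms] by auto
  have "\<exists>ks. set ks \<subseteq> {1..<n} \<and> apply_adj_transps ks = apply_transps xs"
    using xs(1)
  proof (induction xs)
    case (Cons x xs)
    then obtain ks where IH: "set ks \<subseteq> {1..<n}" "apply_adj_transps ks = apply_transps xs"
      by auto
    \<comment> \<open>The pairs obtained so far are unordered, whereas \<open>adj_transp_seq\<close>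
      expects the smaller entry first.\<close>
    define a b where "a = min (fst x) (snd x)" and "b = max (fst x) (snd x)"
    have ab: "1 \<le> a" "a < b" "b \<le> n"
      using Cons.prems by (auto simp: a_def b_def)
    have "apply_adj_transps (adj_transp_seq a b) = Transposition.transpose (fst x) (snd x)"
      using adj_transp_seq_correct[OF ab(2)]
      by (auto simp: a_def b_def min_def max_def transpose_commute split: if_splits)
    then have "apply_adj_transps (adj_transp_seq a b @ ks) = apply_transps (x # xs)"
      using IH(2) by (simp add: apply_adj_transps_conv_apply_transps)
    moreover have "set (adj_transp_seq a b @ ks) \<subseteq> {1..<n}"
      using IH(1) set_adj_transp_seq[of a b] ab by fastforce
    ultimately show ?case
      by blast
  qed (auto intro: exI[of _ "[]"])
  then obtain ks where ks: "set ks \<subseteq> {1..<n}" "apply_adj_transps ks = w"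
    using xs(2) by auto
  then show ?thesis
    by (intro bexI[of _ "map (\<lambda>i. (i, i + 1)) ks"])
       (auto simp: transposition_factorizations_def apply_adj_transps_conv_apply_transps)
qed

lemma coxeter_length_eq_total_crossings_iff:
  assumes w: "w permutes {1..n}"
  shows "coxeter_length n w = total_crossings n w \<longleftrightarrow> avoids_321 w"
proof -
  let ?A = "{length ts | ts. ts \<in> transposition_factorizations n w \<and> (\<forall>(i, j) \<in> set ts. j = i + 1)}"
  have lower: "total_crossings n w \<le> x" if "x \<in> ?A" for x
    using that
  proof clarify
    fix ts
    assume ts: "ts \<in> transposition_factorizations n w" and adj: "\<forall>(i, j) \<in> set ts. j = i + 1"
    have "\<forall>(i, j) \<in> set ts. i < j \<and> j \<le> n"
      using transposition_factorizationsD(1)[OF ts] by auto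
    from total_crossings_apply_transps_le[OF this] show "total_crossings n w \<le> length ts"
      using transposition_factorizationsD(2)[OF ts] sum_list_depths_adjacent[OF adj] by simp
  qed
  show ?thesis
  proof
    assume "avoids_321 w"
    then obtain ts where "ts \<in> transposition_factorizations n w" "\<forall>(i, j) \<in> set ts. j = i + 1"
        and len: "length ts = total_crossings n w"
      using adjacent_factorization_if_avoids_321[OF w] by blast
    then have "length ts \<in> ?A"
      by blast
    then have "total_crossings n w \<in> ?A"
      by (simp only: len)
    then show "coxeter_length n w = total_crossings n w"
      unfolding coxeter_length_def using lower by (rule Inf_nat_eqI)
  next
    assume eq: "coxeter_length n w = total_crossings n w"
    obtain ts0 where "ts0 \<in> transposition_factorizations n w" "\<forall>(i, j) \<in> set ts0. j = i + 1"
      using adjacent_factorization_exists[OF w] by blast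
    then have "length ts0 \<in> ?A"
      by blast
    \<comment> \<open>Nonemptiness makes the infimum an attained minimum, so some adjacent
      factorization has exactly this length.\<close>
    then have "Inf ?A \<in> ?A"
      by (rule wellorder_InfI)
    then have "total_crossings n w \<in> ?A"
      using eq by (simp only: coxeter_length_def)
    then obtain ts where ts: "total_crossings n w = length ts"
        "ts \<in> transposition_factorizations n w" "\<forall>(i, j) \<in> set ts. j = i + 1"
      by (elim CollectE exE conjE) (rule that)
    have "avoids_321 (apply_transps ts)"
      using ts transposition_factorizationsD[OF ts(2)]
      by (intro avoids_321_if_adjacent_factorization[of _ n]) auto
    then show "avoids_321 w"
      using transposition_factorizationsD[OF ts(2)] by simp
  qed
qed

section \<open>Reflection length\<close>

definition invariant_sets :: "nat \<Rightarrow> (nat \<Rightarrow> nat) \<Rightarrow> nat set set" where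
  "invariant_sets n w = {S. S \<subseteq> {1..n} \<and> (\<forall>x. w x \<in> S \<longleftrightarrow> x \<in> S)}"

lemma finite_invariant_sets [simp]: "finite (invariant_sets n w)"
  by (rule finite_subset[of _ "Pow {1..n}"]) (auto simp: invariant_sets_def)

lemma card_invariant_sets_id [simp]: "card (invariant_sets n id) = 2 ^ n"
proof -
  have "invariant_sets n id = Pow {1..n}"
    by (auto simp: invariant_sets_def)
  then show ?thesis
    by (simp add: card_Pow)
qed

lemma sym_diff_invariant_sets:
  "\<lbrakk>S \<in> invariant_sets n w; T \<in> invariant_sets n w\<rbrakk> \<Longrightarrow> sym_diff S T \<in> invariant_sets n w"
  by (auto simp: invariant_sets_def)

lemma inj_on_sym_diff: "inj_on (\<lambda>S. sym_diff S T) A"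
  by (rule inj_onI) blast

lemma invariant_sets_comp_transpose:
  assumes "S \<in> invariant_sets n w" "i \<in> S \<longleftrightarrow> j \<in> S"
  shows "S \<in> invariant_sets n (w \<circ> Transposition.transpose i j)"
  using assms by (auto simp: invariant_sets_def Transposition.transpose_def)

text \<open>The number of invariant sets is \<open>2\<close> to the number of cycles; the invariant sets form a vector
  space under symmetric difference, and \<open>i \<in> S \<longleftrightarrow> j \<in> S\<close> imposes one linear condition.\<close>

lemma card_invariant_sets_comp_transpose:
  "card (invariant_sets n w) \<le> 2 * card (invariant_sets n (w \<circ> Transposition.transpose i j))"
proof -
  define F where "F = {S \<in> invariant_sets n w. i \<in> S \<longleftrightarrow> j \<in> S}"
  define G where "G = {S \<in> invariant_sets n w. \<not> (i \<in> S \<longleftrightarrow> j \<in> S)}"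
  have fin: "finite F" "finite G"
    by (auto simp: F_def G_def)
  have "card G \<le> card F"
  proof (cases "G = {}")
    case False
    then obtain T where T: "T \<in> G" by auto
    have "(\<lambda>S. sym_diff S T) ` G \<subseteq> F"
      using T sym_diff_invariant_sets[of _ n w T] by (auto simp: F_def G_def)
    then show ?thesis
      using fin inj_on_sym_diff by (intro card_inj_on_le) auto
  qed simp
  moreover have "card F \<le> card (invariant_sets n (w \<circ> Transposition.transpose i j))"
    by (intro card_mono) (auto simp: F_def intro: invariant_sets_comp_transpose)
  moreover have "card (invariant_sets n w) = card F + card G"
    using fin by (subst card_Un_disjoint[symmetric]) (auto simp: F_def G_def intro!: arg_cong[of _ _ card])
  ultimately show ?thesis
    by linarith
qed

text \<open>The identity has 2^n invariant sets and each factor at most halves their number. This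
  bounds the length of every factorization from below.\<close>

lemma card_invariant_sets_ge:
  "2 ^ n \<le> 2 ^ length ts * card (invariant_sets n (apply_transps ts))"
proof (induction ts rule: rev_induct)
  case (snoc x ts)
  note snoc
  also have "2 ^ length ts * card (invariant_sets n (apply_transps ts))
      \<le> 2 ^ length ts * (2 * card (invariant_sets n (apply_transps (ts @ [x]))))"
    using card_invariant_sets_comp_transpose[of n "apply_transps ts" "fst x" "snd x"]
    by (intro mult_left_mono) (auto simp: o_def)
  finally show ?case
    by (simp add: mult_ac o_def)
qed (simp add: card_invariant_sets_id[unfolded id_def])

lemma apply_transps_le_iff:
  assumes "\<forall>(a, b) \<in> set ts. a \<le> i \<longleftrightarrow> b \<le> (i::nat)"
  shows "apply_transps ts x \<le> i \<longleftrightarrow> x \<le> i"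
  using assms by (induction ts) (auto simp: Transposition.transpose_def)

text \<open>As \<open>u\<close> preserves {..i}, the product sends just one point out of {..i},
  namely i, and just one point in, namely i + 1. Within an invariant set as many points enter {..i}
  as leave it, so it contains both or neither.\<close>

lemma invariant_sets_adjacent:
  assumes le: "\<And>x. u x \<le> i \<longleftrightarrow> x \<le> i" and "bij u"
    and S: "S \<in> invariant_sets n (u \<circ> Transposition.transpose i (i + 1))"
  shows "i \<in> S \<longleftrightarrow> i + 1 \<in> S"
proof -
  let ?w = "u \<circ> Transposition.transpose i (i + 1)"
  have inv: "?w x \<in> S \<longleftrightarrow> x \<in> S" for x
    using S by (auto simp: invariant_sets_def)
  have "bij ?w"
    by (intro bij_comp bij_transpose \<open>bij u\<close>)
  then have inj: "inj ?w" and surj: "surj ?w"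
    by (simp_all only: bij_def)
  let ?A = "S \<inter> {..i}"
  have wle: "?w x \<le> i" if "x < i \<or> x = i + 1" for x
  proof -
    have "Transposition.transpose i (i + 1) x \<le> i"
      using that by (auto simp: Transposition.transpose_def)
    then show ?thesis
      by (simp only: le o_apply)
  qed
  have wgt: "i < ?w x" if "x = i \<or> i + 1 < x" for x
  proof -
    have "i < Transposition.transpose i (i + 1) x"
      using that by (auto simp: Transposition.transpose_def)
    then show ?thesis
      by (simp only: le o_apply not_le[symmetric] not_False_eq_True)
  qed
  show ?thesis
  proof
    assume "i \<in> S"
    show "i + 1 \<in> S"
    proof (rule ccontr)
      assume "i + 1 \<notin> S"
      \<comment> \<open>Preimages of \<open>?A\<close> lie in S; i is sent out, and the only
        entrance i + 1 is missing from S.\<close>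
      have "?A \<subseteq> ?w ` (?A - {i})"
      proof
        fix y assume y: "y \<in> ?A"
        obtain x where x: "y = ?w x"
          using surj by (metis surjD)
        have "x \<in> S"
          using y x inv by auto
        moreover have "x \<noteq> i" "\<not> i + 1 < x"
          using wgt[of x] y x by auto
        ultimately show "y \<in> ?w ` (?A - {i})"
          using x \<open>i + 1 \<notin> S\<close> by (intro image_eqI[of _ _ x]) (auto simp: le_less_Suc_eq not_less le_Suc_eq)
      qed
      then have "card ?A \<le> card (?A - {i})"
        by (intro surj_card_le) auto
      moreover have "card (?A - {i}) < card ?A"
        using \<open>i \<in> S\<close> by (intro psubset_card_mono) auto
      ultimately show False
        by simp
    qed
  next
    assume "i + 1 \<in> S"
    show "i \<in> S"
    proof (rule ccontr)
      assume "i \<notin> S"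
      \<comment> \<open>Without i nothing leaves \<open>?A\<close>, while i + 1 enters: an injection
        into a smaller finite set.\<close>
      have "?w ` insert (i + 1) ?A \<subseteq> ?A"
      proof (rule image_subsetI)
        fix x assume x: "x \<in> insert (i + 1) ?A"
        then have "x < i \<or> x = i + 1" "x \<in> S"
          using \<open>i + 1 \<in> S\<close> \<open>i \<notin> S\<close> by (auto simp: le_less)
        then show "?w x \<in> ?A"
          using wle[of x] inv[of x] by simp
      qed
      then have "card (insert (i + 1) ?A) \<le> card ?A"
        by (intro card_inj_on_le[OF inj_on_subset[OF inj subset_UNIV]]) auto
      then show False
        by simp
    qed
  qed
qed

text \<open>Here each factor at least halves the number of invariant sets. Its pair does not occur
  earlier, so the product of the earlier factors preserves {..i}, and {1..i} is an invariant set
  separating i from i + 1. Symmetric difference with {1..i} maps the invariant sets of the new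
  product, which do not separate the two points, to invariant sets of the old one that do.\<close>

lemma card_invariant_sets_distinct_adjacent:
  assumes "\<forall>(i, j) \<in> set ts. 1 \<le> i \<and> j = i + 1 \<and> j \<le> n" "distinct ts"
  shows "2 ^ length ts * card (invariant_sets n (apply_transps ts)) \<le> 2 ^ n"
  using assms
proof (induction ts rule: rev_induct)
  case (snoc x ts)
  obtain i where x: "x = (i, i + 1)"
    using snoc.prems(1) by (cases x) auto
  let ?u = "apply_transps ts"
  let ?w = "?u \<circ> Transposition.transpose i (i + 1)"
  have i: "1 \<le> i" "i < n"
    using snoc.prems(1) by (auto simp: x)
  have "\<forall>(a, b) \<in> set ts. a \<le> i \<longleftrightarrow> b \<le> i"
  proof clarify
    fix a b assume ab: "(a, b) \<in> set ts"
    then have "b = a + 1"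
      using snoc.prems(1) by auto
    moreover have "a \<noteq> i"
      using snoc.prems(2) ab \<open>b = a + 1\<close> by (auto simp: x)
    ultimately show "a \<le> i \<longleftrightarrow> b \<le> i"
      by auto
  qed
  then have le: "?u y \<le> i \<longleftrightarrow> y \<le> i" for y
    by (rule apply_transps_le_iff)
  have u: "?u permutes {1..n}"
    using snoc.prems(1) by (intro permutes_apply_transps) auto
  \<comment> \<open>\<open>le\<close> concerns {..i}; invariance of {1..i} also needs 0 to be
    fixed.\<close>
  have u0: "?u y = 0 \<longleftrightarrow> y = 0" for y
    using permutes_not_in[OF u, of 0] injD[OF permutes_inj[OF u], of y 0] by auto
  have T: "{1..i} \<in> invariant_sets n ?u"
    using i by (auto simp: invariant_sets_def le u0 Suc_le_eq simp flip: neq0_conv)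
  have sep: "i \<in> S \<longleftrightarrow> i + 1 \<in> S" if "S \<in> invariant_sets n ?w" for S
    using invariant_sets_adjacent[OF le _ that] permutes_bij[OF u] by auto
  have "Transposition.transpose i (i + 1) \<circ> Transposition.transpose i (i + 1) = id"
    by simp
  then have ww: "?w \<circ> Transposition.transpose i (i + 1) = ?u"
    by (simp add: comp_assoc)
  have sub: "invariant_sets n ?w \<subseteq> {S \<in> invariant_sets n ?u. i \<in> S \<longleftrightarrow> i + 1 \<in> S}"
    using sep invariant_sets_comp_transpose[of _ n ?w i "i + 1"] unfolding ww by blast
  let ?f = "\<lambda>S. sym_diff S {1..i}"
  have img: "?f ` invariant_sets n ?w \<subseteq> {S \<in> invariant_sets n ?u. \<not> (i \<in> S \<longleftrightarrow> i + 1 \<in> S)}"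
  proof
    fix R assume "R \<in> ?f ` invariant_sets n ?w"
    then obtain S where S: "S \<in> invariant_sets n ?w" "R = ?f S"
      by auto
    have "R \<in> invariant_sets n ?u"
      using sub S sym_diff_invariant_sets[OF _ T] by auto
    then show "R \<in> {S \<in> invariant_sets n ?u. \<not> (i \<in> S \<longleftrightarrow> i + 1 \<in> S)}"
      using sep[OF S(1)] i S(2) by auto
  qed
  have "card (invariant_sets n ?w) + card (?f ` invariant_sets n ?w)
      = card (invariant_sets n ?w \<union> ?f ` invariant_sets n ?w)"
    using sub img by (intro card_Un_disjoint[symmetric]) auto
  also have "\<dots> \<le> card (invariant_sets n ?u)"
    using sub img by (intro card_mono) auto
  finally have "2 * card (invariant_sets n ?w) \<le> card (invariant_sets n ?u)"
    using inj_on_sym_diff by (subst (asm) card_image) auto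
  then have "2 ^ length ts * (2 * card (invariant_sets n ?w)) \<le> 2 ^ length ts * card (invariant_sets n ?u)"
    by (rule mult_left_mono) simp
  also have "\<dots> \<le> 2 ^ n"
    using snoc by auto
  finally show ?case
    by (simp add: x mult_ac o_def)
qed (simp add: card_invariant_sets_id[unfolded id_def])

text \<open>Both factorizations have the same product and hence the same number of invariant sets,
  so the upper bound for the one and the lower bound for the other compare the lengths.\<close>

lemma distinct_adjacent_minimal:
  assumes "\<forall>(i, j) \<in> set ts. 1 \<le> i \<and> j = i + 1 \<and> j \<le> (n::nat)" "distinct ts"
    and "apply_transps ts = apply_transps ts'"
  shows "length ts \<le> length ts'"
proof -
  let ?N = "card (invariant_sets n (apply_transps ts))"
  have "2 ^ length ts * ?N \<le> 2 ^ n"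
    by (rule card_invariant_sets_distinct_adjacent[OF assms(1,2)])
  also have "\<dots> \<le> 2 ^ length ts' * ?N"
    using card_invariant_sets_ge[of n ts'] assms(3) by (simp only:)
  finally have "2 ^ length ts * ?N \<le> 2 ^ length ts' * ?N" .
  moreover have "?N > 0"
    using card_invariant_sets_ge[of n ts] by (cases ?N) auto
  ultimately show ?thesis
    by simp
qed

section \<open>Shortening a factorization with a repeated factor\<close>

definition conjugate_transp :: "nat \<times> nat \<Rightarrow> nat \<times> nat \<Rightarrow> nat \<times> nat" where
  "conjugate_transp x y =
     (let t = Transposition.transpose (fst x) (snd x)
      in (min (t (fst y)) (t (snd y)), max (t (fst y)) (t (snd y))))"

lemma transpose_conjugate_transp:
  "Transposition.transpose (fst (conjugate_transp x y)) (snd (conjugate_transp x y)) =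
   Transposition.transpose (fst x) (snd x) \<circ> Transposition.transpose (fst y) (snd y) \<circ>
   Transposition.transpose (fst x) (snd x)"
proof -
  let ?t = "Transposition.transpose (fst x) (snd x)"
  have "Transposition.transpose (fst (conjugate_transp x y)) (snd (conjugate_transp x y))
      = Transposition.transpose (?t (fst y)) (?t (snd y))"
    by (auto simp: conjugate_transp_def Let_def min_def max_def transpose_commute)
  also have "\<dots> = (Transposition.transpose (?t (fst y)) (?t (snd y)) \<circ> ?t) \<circ> ?t"
    by (simp only: comp_assoc transpose_comp_involutory comp_id)
  also have "\<dots> = ?t \<circ> Transposition.transpose (fst y) (snd y) \<circ> ?t"
    using transpose_comp_eq[OF bij_transpose, of "?t (fst y)" "?t (snd y)" "fst x" "snd x"]
    by (simp only: inv_transpose_eq transpose_involutory)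
  finally show ?thesis .
qed

lemma apply_transps_conjugate:
  "apply_transps (map (conjugate_transp x) ts) =
   Transposition.transpose (fst x) (snd x) \<circ> apply_transps ts \<circ> Transposition.transpose (fst x) (snd x)"
  by (induction ts) (simp_all add: transpose_conjugate_transp fun_eq_iff)

lemma conjugate_transp_bounds:
  assumes "1 \<le> fst x \<and> fst x < snd x \<and> snd x \<le> n" "1 \<le> fst y \<and> fst y < snd y \<and> snd y \<le> n"
  shows "1 \<le> fst (conjugate_transp x y) \<and> fst (conjugate_transp x y) < snd (conjugate_transp x y) \<and>
         snd (conjugate_transp x y) \<le> n"
proof -
  let ?t = "Transposition.transpose (fst x) (snd x)"
  have rng: "1 \<le> ?t z \<and> ?t z \<le> n" if "1 \<le> z \<and> z \<le> n" for z
    using assms(1) that by (simp add: Transposition.transpose_def)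
  have "?t (fst y) \<noteq> ?t (snd y)"
    using assms(2) by (simp add: inj_eq[OF bij_is_inj[OF bij_transpose]])
  moreover have "1 \<le> ?t (fst y) \<and> ?t (fst y) \<le> n" "1 \<le> ?t (snd y) \<and> ?t (snd y) \<le> n"
    using assms(2) by (intro rng; simp)+
  ultimately show ?thesis
    by (simp add: conjugate_transp_def Let_def min_def max_def)
qed

lemma shorten_repeated_transposition:
  assumes "ts \<in> transposition_factorizations n w" "\<not> distinct ts"
  shows "\<exists>ts' \<in> transposition_factorizations n w. length ts' < length ts"
proof -
  obtain as bs cs x where ts: "ts = as @ [x] @ bs @ [x] @ cs"
    using not_distinct_decomp[OF assms(2)] by blast
  \<comment> \<open>Since x is an involution, x bs x equals the product of the conjugated factors;
    both copies of x disappear.\<close>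
  let ?ts = "as @ map (conjugate_transp x) bs @ cs"
  have bd: "1 \<le> fst y \<and> fst y < snd y \<and> snd y \<le> n" if "y \<in> set ts" for y
    using transposition_factorizationsD(1)[OF assms(1), of "fst y" "snd y"] that by simp
  have "apply_transps ?ts = w"
    using transposition_factorizationsD(2)[OF assms(1)]
    by (simp add: ts apply_transps_conjugate comp_assoc)
  moreover have "1 \<le> fst y \<and> fst y < snd y \<and> snd y \<le> n" if "y \<in> set ?ts" for y
  proof (cases "y \<in> set ts")
    case False
    then obtain z where "y = conjugate_transp x z" "z \<in> set bs"
      using \<open>y \<in> set ?ts\<close> by (auto simp: ts)
    then show ?thesis
      using conjugate_transp_bounds[OF bd[of x] bd[of z]] by (simp add: ts)
  qed (rule bd)
  ultimately have "?ts \<in> transposition_factorizations n w"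
    unfolding transposition_factorizations_def mem_Collect_eq case_prod_unfold by blast
  then show ?thesis
    by (intro bexI[of _ ?ts]) (simp_all add: ts)
qed

section \<open>Crossing numbers at most one and the pattern 3412\<close>

lemma crossings_eq_card_down:
  assumes "bij w"
  shows "crossings w k = card {b. k < b \<and> w b \<le> k}" "finite {b. k < b \<and> w b \<le> k}"
proof -
  have inj: "inj w" and surj: "surj w"
    using assms by (auto simp: bij_def)
  have card: "card (w ` {..k}) = card {..k}"
    using inj_on_subset[OF inj] by (intro card_image) auto
  \<comment> \<open>The sets {..k} and its image have equal size, so as many values leave {..k} as
    are supplied from above k.\<close>
  have up: "w ` {..k} - {..k} = w ` {a. a \<le> k \<and> k < w a}"
    by auto
  have down: "{..k} - w ` {..k} = w ` {b. k < b \<and> w b \<le> k}"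
  proof (intro equalityI subsetI)
    fix y assume y: "y \<in> {..k} - w ` {..k}"
    obtain b where "y = w b"
      using surj by (rule surjE)
    with y show "y \<in> w ` {b. k < b \<and> w b \<le> k}"
      by (auto simp: not_le[symmetric])
  qed (auto simp: inj_eq[OF inj])
  have "card (w ` {..k} - {..k}) = card ({..k} - w ` {..k})"
    using card card_Diff_subset_Int[of "w ` {..k}" "{..k}"] card_Diff_subset_Int[of "{..k}" "w ` {..k}"]
    by (simp add: Int_commute)
  then show "crossings w k = card {b. k < b \<and> w b \<le> k}"
    unfolding up down crossings_def using inj_on_subset[OF inj] by (simp add: card_image)
  have "finite (w ` {b. k < b \<and> w b \<le> k})"
    unfolding down[symmetric] by simp
  then show "finite {b. k < b \<and> w b \<le> k}"
    using inj_on_subset[OF inj] by (meson finite_imageD subset_UNIV)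
qed

lemma two_elements_if_card_gt_1:
  fixes A :: "nat set"
  assumes "1 < card A"
  obtains x y where "x \<in> A" "y \<in> A" "x < y"
proof -
  obtain x y where "x \<in> A" "y \<in> A" "x \<noteq> y"
    using assms by (metis One_nat_def card_le_Suc0_iff_eq card.infinite not_less not_one_less_zero)
  then show ?thesis
    using that by (cases x y rule: linorder_cases) auto
qed

text \<open>Two positions a < b crossing level k upwards come with two positions c < d crossing it
  downwards. Avoiding 321 makes both pairs increasing, and together they form a 3412.\<close>

lemma crossings_le_1_if_avoids:
  assumes "bij w" "avoids_321 w" "avoids_3412 w"
  shows "crossings w k \<le> 1"
proof (rule ccontr)
  assume "\<not> crossings w k \<le> 1"
  then have up: "1 < card {a. a \<le> k \<and> k < w a}" and down: "1 < card {b. k < b \<and> w b \<le> k}"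
    using crossings_eq_card_down(1)[OF assms(1)] by (auto simp: crossings_def)
  obtain a b where ab: "a < b" "a \<le> k" "b \<le> k" "k < w a" "k < w b"
    using two_elements_if_card_gt_1[OF up] by blast
  obtain c d where cd: "c < d" "k < c" "k < d" "w c \<le> k" "w d \<le> k"
    using two_elements_if_card_gt_1[OF down] by blast
  have inj: "w x \<noteq> w y" if "x < y" for x y
    using injD[OF bij_is_inj[OF assms(1)], of x y] that by auto
  have no: "\<not> (w z < w y \<and> w y < w x)" if "x < y" "y < z" for x y z
    using assms(2) that unfolding avoids_321_def by blast
  have "w a < w b"
    using no[of a b c] inj[of a b] ab cd by linarith
  moreover have "w c < w d"
    using no[of b c d] inj[of c d] ab cd by linarith
  moreover have "w d < w a" "b < c"
    using ab cd by auto
  ultimately show False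
    using assms(3) ab(1) cd(1) unfolding avoids_3412_def by blast
qed

lemma avoids_3412_if_crossings_le_1:
  assumes "bij w" "\<And>k. crossings w k \<le> 1"
  shows "avoids_3412 w"
  unfolding avoids_3412_def
proof (intro allI impI notI)
  fix a b c d :: nat
  assume abcd: "a < b" "b < c" "c < d" and p: "w c < w d \<and> w d < w a \<and> w a < w b"
  show False
  \<comment> \<open>In the first case a and b both cross level b upwards. Otherwise w(a) \<le> b < c
    < d, and c and d both cross level w(a) - 1 downwards.\<close>
  proof (cases "b < w a")
    case True
    then have "card {a, b} \<le> crossings w b"
      unfolding crossings_def using abcd p by (intro card_mono) auto
    then show False
      using assms(2)[of b] abcd by simp
  next
    case False
    then have "card {c, d} \<le> crossings w (w a - 1)"
      unfolding crossings_eq_card_down(1)[OF assms(1)] using abcd p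
      by (intro card_mono crossings_eq_card_down(2)[OF assms(1)]) auto
    then show False
      using assms(2)[of "w a - 1"] abcd by simp
  qed
qed

lemma count_adjacent_le_filter:
  fixes k :: nat
  shows "count_list ts (k, k + 1) \<le> length (filter (\<lambda>(i, j). i \<le> k \<and> k < j) ts)"
  by (induction ts) auto

text \<open>Equality of the sums over all levels forces equality at each level. A repeated factor
  (k, k + 1) would give level k a count of at least two.\<close>

lemma distinct_if_crossings_le_1:
  assumes "\<forall>(i, j) \<in> set ts. 1 \<le> i \<and> j = i + 1 \<and> j \<le> n"
    and "length ts = total_crossings n (apply_transps ts)"
    and "\<And>k. crossings (apply_transps ts) k \<le> 1"
  shows "distinct ts"
proof -
  let ?f = "\<lambda>k. length (filter (\<lambda>(i, j). i \<le> k \<and> k < j) ts)"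
  have "(\<Sum>k<n. crossings (apply_transps ts) k) = (\<Sum>k<n. ?f k)"
  proof -
    have "\<forall>(i, j) \<in> set ts. i < j \<and> j \<le> n" "\<forall>(i, j) \<in> set ts. j = i + 1"
      using assms(1) by auto
    from sum_length_filter_straddle[OF this(1)] sum_list_depths_adjacent[OF this(2)] show ?thesis
      using assms(2) unfolding total_crossings_def by simp
  qed
  moreover have "crossings (apply_transps ts) k \<le> ?f k" for k
    using assms(1) by (intro crossings_apply_transps_le) auto
  ultimately have eq: "crossings (apply_transps ts) k = ?f k" if "k < n" for k
    using sum_mono_inv[of "crossings (apply_transps ts)" "{..<n}" ?f k] that by auto
  have "count_list ts x \<le> 1" if "x \<in> set ts" for x
  proof -
    obtain k j where kj: "x = (k, j)"
      by (cases x)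
    then have x: "x = (k, k + 1)" and k: "k < n"
      using assms(1) that by auto
    show ?thesis
      using count_adjacent_le_filter[of ts k] eq[OF k] assms(3)[of k] by (simp add: x)
  qed
  moreover have "\<exists>x \<in> set ts. 2 \<le> count_list ts x" if "\<not> distinct ts"
    using not_distinct_decomp[OF that] by fastforce
  ultimately show ?thesis
    by force
qed

lemma reflection_length_le:
  "ts \<in> transposition_factorizations n w \<Longrightarrow> reflection_length n w \<le> length ts"
  unfolding reflection_length_def by (intro cInf_lower) auto

lemma reflection_length_eq_total_crossings_iff:
  assumes w: "w permutes {1..n}"
  shows "reflection_length n w = total_crossings n w \<longleftrightarrow> avoids_321 w \<and> avoids_3412 w"
proof
  assume av: "avoids_321 w \<and> avoids_3412 w"
  obtain ts where ts: "ts \<in> transposition_factorizations n w"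
      "\<forall>(i, j) \<in> set ts. j = i + 1" "length ts = total_crossings n w"
    using adjacent_factorization_if_avoids_321[OF w] av by blast
  have app: "apply_transps ts = w"
    by (rule transposition_factorizationsD(2)[OF ts(1)])
  have adj: "\<forall>(i, j) \<in> set ts. 1 \<le> i \<and> j = i + 1 \<and> j \<le> n"
    using ts(2) transposition_factorizationsD(1)[OF ts(1)] by fastforce
  have "distinct ts"
    using crossings_le_1_if_avoids[OF permutes_bij[OF w]] av ts(3) adj app
    by (intro distinct_if_crossings_le_1[of ts n]) auto
  then have min: "length ts \<le> length ts'" if "ts' \<in> transposition_factorizations n w" for ts'
    using distinct_adjacent_minimal[OF adj] transposition_factorizationsD(2)[OF that] app by auto
  show "reflection_length n w = total_crossings n w"
    unfolding reflection_length_def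
  proof (rule Inf_nat_eqI)
    have "length ts \<in> {length ts | ts. ts \<in> transposition_factorizations n w}"
      using ts(1) by blast
    then show "total_crossings n w \<in> {length ts | ts. ts \<in> transposition_factorizations n w}"
      by (simp only: ts(3))
    show "total_crossings n w \<le> x" if "x \<in> {length ts | ts. ts \<in> transposition_factorizations n w}" for x
      using that min by (elim CollectE exE conjE) (simp only: ts(3))
  qed
next
  assume eq: "reflection_length n w = total_crossings n w"
  obtain ts where ts: "ts \<in> transposition_factorizations n w"
      "(\<Sum>(i, j)\<leftarrow>ts. j - i) = total_crossings n w"
    using factorization_of_depth_total_crossings[OF w] by blast
  have app: "apply_transps ts = w"
    by (rule transposition_factorizationsD(2)[OF ts(1)])
  have bd: "\<forall>(i, j) \<in> set ts. 1 \<le> i \<and> i < j \<and> j \<le> n"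
    using transposition_factorizationsD(1)[OF ts(1)] by auto
  have "length ts \<ge> (\<Sum>(i, j)\<leftarrow>ts. j - i)"
    using reflection_length_le[OF ts(1)] eq ts(2) by simp
  \<comment> \<open>Every factor has depth at least one, so a length not below the total depth
    forces all depths to be one.\<close>
  then have "length ts = (\<Sum>(i, j)\<leftarrow>ts. j - i) \<and> (\<forall>(i, j) \<in> set ts. j = i + 1)"
    using bd
  proof (induction ts)
    case (Cons x ts)
    have "length ts \<le> (\<Sum>(i, j)\<leftarrow>ts. j - i)"
      using Cons.prems(2) by (induction ts) auto
    moreover obtain i j where x: "x = (i, j)"
      by (cases x)
    moreover have "i < j" and bd: "\<forall>(i, j) \<in> set ts. 1 \<le> i \<and> i < j \<and> j \<le> n"
      using Cons.prems(2) x by auto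
    moreover have "(j - i) + (\<Sum>(i, j)\<leftarrow>ts. j - i) \<le> Suc (length ts)"
      using Cons.prems(1) by (simp add: x)
    ultimately have "(\<Sum>(i, j)\<leftarrow>ts. j - i) = length ts" "j = i + 1"
      by linarith+
    then show ?case
      using Cons.IH[OF _ bd] x by simp
  qed simp
  then have len: "length ts = total_crossings n w"
      and adj: "\<forall>(i, j) \<in> set ts. 1 \<le> i \<and> j = i + 1 \<and> j \<le> n"
    using ts(2) bd by fastforce+
  have "avoids_321 w"
    using avoids_321_if_adjacent_factorization[OF adj] len app by simp
  have "distinct ts"
  proof (rule ccontr)
    assume "\<not> distinct ts"
    then obtain ts' where "ts' \<in> transposition_factorizations n w" "length ts' < length ts"
      using shorten_repeated_transposition[OF ts(1)] by blast
    then show False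
      using reflection_length_le[of ts' n w] eq len by simp
  qed
  have "crossings w k \<le> 1" for k
  proof -
    have "length (filter (\<lambda>(i, j). i \<le> k \<and> k < j) ts) = card (set (filter (\<lambda>(i, j). i \<le> k \<and> k < j) ts))"
      using \<open>distinct ts\<close> by (intro distinct_card[symmetric]) simp
    also have "\<dots> \<le> card {(k, k + 1)}"
      using adj by (intro card_mono) fastforce+
    finally show ?thesis
      using crossings_apply_transps_le[of ts k] bd app by fastforce
  qed
  then show "avoids_321 w \<and> avoids_3412 w"
    using avoids_3412_if_crossings_le_1[OF permutes_bij[OF w]] \<open>avoids_321 w\<close> by blast
qed

section \<open>Insertion of the largest value\<close>

text \<open>For \<open>u\<close> in the symmetric group of degree \<open>m - 1\<close>, the one-line notation of \<open>u \<circ> shift_to p m\<close> is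
  that of \<open>u\<close> with \<open>m\<close> inserted at position \<open>p\<close>.\<close>

definition shift_to :: "nat \<Rightarrow> nat \<Rightarrow> nat \<Rightarrow> nat" where
  "shift_to p m x = (if x = p then m else if p < x \<and> x \<le> m then x - 1 else x)"

lemma shift_to_self [simp]: "shift_to m m = id"
  by (auto simp: shift_to_def)

lemma shift_to_at [simp]: "shift_to p m p = m"
  by (simp add: shift_to_def)

lemma shift_to_mono: "x < y \<Longrightarrow> x \<noteq> p \<Longrightarrow> y \<noteq> p \<Longrightarrow> shift_to p m x < shift_to p m y"
  by (auto simp: shift_to_def)

lemma shift_to_permutes:
  assumes "1 \<le> p" "p \<le> m"
  shows "shift_to p m permutes {1..m}"
proof (rule bij_imp_permutes)
  show "bij_betw (shift_to p m) {1..m} {1..m}"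
    by (rule bij_betw_byWitness[where f' = "\<lambda>x. if x = m then p else if p \<le> x then x + 1 else x"])
       (use assms in \<open>auto simp: shift_to_def\<close>)
qed (use assms in \<open>auto simp: shift_to_def\<close>)

lemma insert_maximum_permutes:
  assumes "u permutes {1..n}" "1 \<le> p" "p \<le> Suc n"
  shows "u \<circ> shift_to p (Suc n) permutes {1..Suc n}"
proof (rule permutes_compose)
  show "u permutes {1..Suc n}"
    using assms(1) by (rule permutes_subset) simp
  show "shift_to p (Suc n) permutes {1..Suc n}"
    using assms(2,3) by (rule shift_to_permutes)
qed

lemma bij_betw_insert_maximum:
  assumes "1 \<le> p" "p \<le> Suc n"
  shows "bij_betw (\<lambda>u. u \<circ> shift_to p (Suc n)) {u. u permutes {1..n}}
           {w. w permutes {1..Suc n} \<and> w p = Suc n}"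
proof -
  let ?t = "shift_to p (Suc n)"
  have t: "?t permutes {1..Suc n}"
    using assms by (intro shift_to_permutes)
  have "inv ?t (Suc n) = p"
    using permutes_inv_eq[OF t] by simp
  show ?thesis
  proof (rule bij_betw_byWitness[where f' = "\<lambda>w. w \<circ> inv ?t"])
    show "\<forall>u \<in> {u. u permutes {1..n}}. (u \<circ> ?t) \<circ> inv ?t = u"
      using permutes_inv_o(1)[OF t] by (simp add: comp_assoc)
    show "\<forall>w \<in> {w. w permutes {1..Suc n} \<and> w p = Suc n}. (w \<circ> inv ?t) \<circ> ?t = w"
      using permutes_inv_o(2)[OF t] by (simp add: comp_assoc)
    show "(\<lambda>u. u \<circ> ?t) ` {u. u permutes {1..n}} \<subseteq> {w. w permutes {1..Suc n} \<and> w p = Suc n}"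
    proof (rule image_subsetI)
      fix u assume "u \<in> {u. u permutes {1..n}}"
      then have u: "u permutes {1..n}"
        by simp
      have "u \<circ> ?t permutes {1..Suc n}"
        using u assms by (rule insert_maximum_permutes)
      then show "u \<circ> ?t \<in> {w. w permutes {1..Suc n} \<and> w p = Suc n}"
        using permutes_not_in[OF u, of "Suc n"] by simp
    qed
    show "(\<lambda>w. w \<circ> inv ?t) ` {w. w permutes {1..Suc n} \<and> w p = Suc n} \<subseteq> {u. u permutes {1..n}}"
    proof (rule image_subsetI)
      fix w assume "w \<in> {w. w permutes {1..Suc n} \<and> w p = Suc n}"
      then have w: "w permutes {1..Suc n}" "w p = Suc n"
        by simp_all
      have "w \<circ> inv ?t permutes {1..Suc n}"
        using w t by (intro permutes_compose permutes_inv)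
      moreover have "(w \<circ> inv ?t) x = x" if "x \<in> {1..Suc n} - {1..n}" for x
      proof -
        have "x = Suc n"
          using that by auto
        then show ?thesis
          using w(2) \<open>inv ?t (Suc n) = p\<close> by simp
      qed
      ultimately have "w \<circ> inv ?t permutes {1..n}"
        by (rule permutes_superset)
      then show "w \<circ> inv ?t \<in> {u. u permutes {1..n}}"
        by simp
    qed
  qed
qed

text \<open>Stated for an arbitrary property \<open>P\<close>, because both counts classify
  permutations by the position of the largest value.\<close>

lemma card_permutations_by_position_of_maximum:
  "card {w. w permutes {1..Suc n} \<and> P w} =
   (\<Sum>p = 1..Suc n. card {u. u permutes {1..n} \<and> P (u \<circ> shift_to p (Suc n))})"
proof -
  let ?W = "\<lambda>p. {w. w permutes {1..Suc n} \<and> P w \<and> w p = Suc n}"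
  have "{w. w permutes {1..Suc n} \<and> P w} = (\<Union>p\<in>{1..Suc n}. ?W p)"
  proof (intro equalityI subsetI)
    fix w assume "w \<in> {w. w permutes {1..Suc n} \<and> P w}"
    then have w: "w permutes {1..Suc n}" "P w"
      by simp_all
    obtain p where "w p = Suc n"
      using permutes_surj[OF w(1)] by (metis surjD)
    moreover have "p \<in> {1..Suc n}"
      using permutes_in_image[OF w(1), of p] \<open>w p = Suc n\<close> by simp
    ultimately show "w \<in> (\<Union>p\<in>{1..Suc n}. ?W p)"
      using w by blast
  qed auto
  moreover have "card (\<Union>p\<in>{1..Suc n}. ?W p) = (\<Sum>p = 1..Suc n. card (?W p))"
  proof (rule card_UN_disjoint)
    show "\<forall>p\<in>{1..Suc n}. finite (?W p)"
      by (auto intro: finite_subset[OF _ finite_permutations[of "{1..Suc n}"]])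
    show "\<forall>p\<in>{1..Suc n}. \<forall>q\<in>{1..Suc n}. p \<noteq> q \<longrightarrow> ?W p \<inter> ?W q = {}"
    proof (intro ballI impI equals0I)
      fix p q w assume "p \<noteq> q" and w: "w \<in> ?W p \<inter> ?W q"
      then have "w p = w q" "inj w"
        using permutes_inj by auto
      then show False
        using \<open>p \<noteq> q\<close> by (simp add: inj_eq)
    qed
  qed simp
  moreover have "card (?W p) = card {u. u permutes {1..n} \<and> P (u \<circ> shift_to p (Suc n))}"
    if "p \<in> {1..Suc n}" for p
  proof -
    have b: "bij_betw (\<lambda>u. u \<circ> shift_to p (Suc n)) {u. u permutes {1..n}}
           {w. w permutes {1..Suc n} \<and> w p = Suc n}"
      using that by (intro bij_betw_insert_maximum) auto
    have "bij_betw (\<lambda>u. u \<circ> shift_to p (Suc n))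
        {u \<in> {u. u permutes {1..n}}. P (u \<circ> shift_to p (Suc n))}
        {w \<in> {w. w permutes {1..Suc n} \<and> w p = Suc n}. P w}"
      by (rule bij_betw_Collect[OF b]) simp
    then show ?thesis
      by (auto dest!: bij_betw_same_card simp: conj_ac)
  qed
  ultimately show ?thesis
    by simp
qed

lemma permutes_eq_of_gt: "u permutes {1..n::nat} \<Longrightarrow> n < x \<Longrightarrow> u x = x"
  by (auto intro: permutes_not_in)

lemma permutes_le_iff: "u permutes {1..n::nat} \<Longrightarrow> u x \<le> n \<longleftrightarrow> x \<le> n"
  using permutes_in_image[of u "{1..n}" x] permutes_not_in[of u "{1..n}" x] by (cases "x \<in> {1..n}") auto

section \<open>Insertions that preserve avoidance\<close>

lemma shift_to_section:
  assumes "p \<le> m"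
  obtains e where "\<And>x. x \<noteq> m \<Longrightarrow> shift_to p m (e x) = x"
    "\<And>x y. x < y \<Longrightarrow> x \<noteq> m \<Longrightarrow> y \<noteq> m \<Longrightarrow> e x < e y"
    "\<And>x. p \<le> x \<Longrightarrow> p < e x"
\<comment> \<open>The embedding sends a position of \<open>u\<close> to its position after the
  insertion, skipping p. It fails at m alone, where m and m + 1 would both go to m + 1.\<close>
proof (rule that[of "\<lambda>x. if x < p \<or> m < x then x else x + 1"])
qed (use assms in \<open>auto simp: shift_to_def split: if_splits\<close>)

text \<open>The inserted largest value can only be the 3 of a 321, so the entries to its right,
  which are those of \<open>u\<close> from position p on, must increase.\<close>

lemma avoids_321_insert_maximum_iff:
  assumes u: "u permutes {1..n}" and p: "1 \<le> p" "p \<le> Suc n"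
  shows "avoids_321 (u \<circ> shift_to p (Suc n)) \<longleftrightarrow> avoids_321 u \<and> strict_mono_on {p..} u"
    (is "avoids_321 ?w \<longleftrightarrow> _")
proof -
  let ?t = "shift_to p (Suc n)"
  have um: "u (Suc n) = Suc n"
    using permutes_eq_of_gt[OF u] by simp
  have uinj: "u x = u y \<longleftrightarrow> x = y" for x y
    using permutes_inj[OF u] by (simp add: inj_eq)
  have wp: "?w p = Suc n"
    using um by simp
  have ule: "u x \<le> n \<longleftrightarrow> x \<le> n" for x
    by (rule permutes_le_iff[OF u])
  have wle: "?w x \<le> Suc n \<longleftrightarrow> x \<le> Suc n" for x
    by (rule permutes_le_iff[OF insert_maximum_permutes[OF u p]])
  obtain e where e: "\<And>x. x \<noteq> Suc n \<Longrightarrow> ?t (e x) = x"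
      "\<And>x y. x < y \<Longrightarrow> x \<noteq> Suc n \<Longrightarrow> y \<noteq> Suc n \<Longrightarrow> e x < e y"
      "\<And>x. p \<le> x \<Longrightarrow> p < e x"
    using shift_to_section[OF p(2)] by metis
  have we: "?w (e x) = u x" if "x \<noteq> Suc n" for x
    using e(1)[OF that] by simp
  show ?thesis
  proof
    assume av: "avoids_321 ?w"
    have no: "\<not> (?w z < ?w y \<and> ?w y < ?w x)" if "x < y" "y < z" for x y z
      using av that unfolding avoids_321_def by blast
    have ne: "x \<noteq> Suc n" "y \<noteq> Suc n" if "x < y" "u y < u x" for x y
    proof -
      show "y \<noteq> Suc n"
        using that um ule[of x] by auto
      show "x \<noteq> Suc n"
        using that um permutes_eq_of_gt[OF u, of y] by auto
    qed
    have "avoids_321 u"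
      unfolding avoids_321_def
    proof (intro allI impI notI)
      fix a b c assume abc: "a < b" "b < c" "u c < u b \<and> u b < u a"
      have nm: "a \<noteq> Suc n" "b \<noteq> Suc n" "c \<noteq> Suc n"
        using ne[of a b] ne[of b c] abc by auto
      show False
        using no[OF e(2)[OF abc(1) nm(1,2)] e(2)[OF abc(2) nm(2,3)]] abc(3)
        by (simp only: we[OF nm(1)] we[OF nm(2)] we[OF nm(3)] simp_thms)
    qed
    moreover have "strict_mono_on {p..} u"
    proof (rule strict_mono_onI)
      fix x y assume xy: "x \<in> {p..}" "y \<in> {p..}" "x < y"
      show "u x < u y"
      proof (rule ccontr)
        assume "\<not> u x < u y"
        then have less: "u y < u x"
          using uinj[of x y] xy by simp
        have nm: "x \<noteq> Suc n" "y \<noteq> Suc n"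
          using ne[OF xy(3) less] by auto
        have "x \<le> n"
        proof (rule ccontr)
          assume "\<not> x \<le> n"
          then show False
            using permutes_eq_of_gt[OF u, of x] permutes_eq_of_gt[OF u, of y] xy less by simp
        qed
        then have ux: "u x < Suc n"
          using ule[of x] by simp
        have pe: "p < e x"
          using e(3) xy(1) by simp
        show False
          using no[OF pe e(2)[OF xy(3) nm]] less ux
          by (simp only: we[OF nm(1)] we[OF nm(2)] wp simp_thms)
      qed
    qed
    ultimately show "avoids_321 u \<and> strict_mono_on {p..} u" ..
  next
    assume rhs: "avoids_321 u \<and> strict_mono_on {p..} u"
    show "avoids_321 ?w"
      unfolding avoids_321_def
    proof (intro allI impI notI)
      fix a b c assume abc: "a < b" "b < c" "?w c < ?w b \<and> ?w b < ?w a"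
      have "b \<noteq> p" "c \<noteq> p"
        using abc wp wle[of a] wle[of b] p by (auto simp del: o_apply)
      show False
      proof (cases "a = p")
        case True
        then have "p \<le> ?t b" "?t b < ?t c"
          using abc shift_to_mono[of b c p "Suc n"] \<open>b \<noteq> p\<close> \<open>c \<noteq> p\<close> p by (auto simp: shift_to_def)
        then have "?w b < ?w c"
          using rhs by (auto intro: strict_mono_onD[of "{p..}" u])
        then show False
          using abc by simp
      next
        case False
        then have "?t a < ?t b" "?t b < ?t c"
          using shift_to_mono \<open>b \<noteq> p\<close> \<open>c \<noteq> p\<close> abc by auto
        then show False
          using rhs abc unfolding avoids_321_def by auto
      qed
    qed
  qed
qed

lemma strict_mono_on_insert_maximum_iff:
  assumes u: "u permutes {1..n}" "strict_mono_on {p..} u" and p: "p \<le> n" and d: "d \<le> Suc n"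
  shows "strict_mono_on {d..} (u \<circ> shift_to p (Suc n)) \<longleftrightarrow> p < d"
proof
  assume inc: "strict_mono_on {d..} (u \<circ> shift_to p (Suc n))"
  show "p < d"
  proof (rule ccontr)
    assume "\<not> p < d"
    then have "(u \<circ> shift_to p (Suc n)) p < (u \<circ> shift_to p (Suc n)) (Suc p)"
      using inc by (intro strict_mono_onD[OF inc]) auto
    then have "Suc n < u p"
      using p permutes_eq_of_gt[OF u(1), of "Suc n"] by (simp add: shift_to_def)
    then show False
      using permutes_le_iff[OF u(1), of p] p by simp
  qed
next
  assume "p < d"
  show "strict_mono_on {d..} (u \<circ> shift_to p (Suc n))"
  proof (rule strict_mono_onI)
    fix x y assume xy: "x \<in> {d..}" "y \<in> {d..}" "x < y"
    then have "shift_to p (Suc n) x < shift_to p (Suc n) y" "p \<le> shift_to p (Suc n) x"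
      using \<open>p < d\<close> by (auto intro: shift_to_mono simp: shift_to_def)
    then show "(u \<circ> shift_to p (Suc n)) x < (u \<circ> shift_to p (Suc n)) y"
      using u(2) by (auto intro: strict_mono_onD[of "{p..}" u])
  qed
qed

section \<open>Counting permutations avoiding 321\<close>

text \<open>For n \<ge> 1 the parameter d interpolates between d = 1, where only the identity
  remains, and d = n, where monotonicity holds automatically.\<close>

definition ballot_number :: "nat \<Rightarrow> nat \<Rightarrow> nat" where
  "ballot_number n d = card {w. w permutes {1..n} \<and> avoids_321 w \<and> strict_mono_on {d..} w}"

text \<open>Inserting n + 1 at the end leaves the condition at d unchanged. Inserting it at p \<le>
  n creates a descent at p, hence p < d, and requires \<open>u\<close> to increase from p
  on.\<close>

lemma ballot_number_Suc:
  assumes "d \<le> Suc n"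
  shows "ballot_number (Suc n) d = ballot_number n d + (\<Sum>p = 1..<d. ballot_number n p)"
proof -
  let ?S = "\<lambda>p. {u. u permutes {1..n} \<and> avoids_321 (u \<circ> shift_to p (Suc n)) \<and>
                    strict_mono_on {d..} (u \<circ> shift_to p (Suc n))}"
  have "?S p = (if p < d then {u. u permutes {1..n} \<and> avoids_321 u \<and> strict_mono_on {p..} u} else {})"
    if "p \<in> {1..n}" for p
    using that assms avoids_321_insert_maximum_iff[of _ n p] strict_mono_on_insert_maximum_iff[of _ n p d]
    by (auto split: if_splits)
  then have "(\<Sum>p = 1..n. card (?S p)) = (\<Sum>p = 1..n. if p < d then ballot_number n p else 0)"
    by (intro sum.cong) (simp_all add: ballot_number_def)
  also have "\<dots> = (\<Sum>p \<in> {p \<in> {1..n}. p < d}. ballot_number n p)"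
    by (rule sum.inter_filter[symmetric]) simp
  also have "{p \<in> {1..n}. p < d} = {1..<d}"
    using assms by auto
  finally have "(\<Sum>p = 1..n. card (?S p)) = (\<Sum>p = 1..<d. ballot_number n p)" .
  moreover have "card (?S (Suc n)) = ballot_number n d"
    by (simp add: ballot_number_def)
  ultimately show ?thesis
    using card_permutations_by_position_of_maximum[of n "\<lambda>w. avoids_321 w \<and> strict_mono_on {d..} w"]
    by (simp add: ballot_number_def)
qed

lemma ballot_number_Suc_Suc:
  assumes "1 \<le> d" "d \<le> n"
  shows "ballot_number (Suc n) (Suc d) = ballot_number (Suc n) d + ballot_number n (Suc d)"
  using assms ballot_number_Suc[of "Suc d" n] ballot_number_Suc[of d n]
  by (simp add: sum.atLeastLessThan_Suc)

lemma strict_mono_on_last: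
  assumes "w permutes {1..n::nat}"
  shows "strict_mono_on {n..} w"
proof (rule strict_mono_onI)
  fix x y assume "x \<in> {n..}" "y \<in> {n..}" "x < y"
  then have "w x \<le> x" "w y = y"
    using permutes_eq_of_gt[OF assms, of y] permutes_eq_of_gt[OF assms, of x] permutes_le_iff[OF assms, of x]
    by (cases "x = n"; simp)+
  then show "w x < w y"
    using \<open>x < y\<close> by simp
qed

lemma ballot_number_all:
  assumes "n \<le> d"
  shows "ballot_number n d = card {w. w permutes {1..n} \<and> avoids_321 w}"
proof -
  have "strict_mono_on {d..} w" if "w permutes {1..n}" for w
    using monotone_on_subset[OF strict_mono_on_last[OF that]] assms by simp
  then show ?thesis
    unfolding ballot_number_def by (intro arg_cong[of _ _ card]) auto
qed

lemma ballot_number_first: "ballot_number (Suc n) 1 = ballot_number n 1"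
  using ballot_number_Suc[of 1 n] by simp

lemma ballot_number_0: "ballot_number 0 d = 1"
  by (simp add: ballot_number_def strict_mono_on_def cong: conj_cong)

text \<open>The inductive step for the closed form, with \<open>G\<close> and \<open>H\<close> the entries at \<open>(n + 1, d)\<close> and \<open>(n, d + 1)\<close>
  and with \<open>n - d\<close> named \<open>j\<close> to avoid truncated subtraction.\<close>

lemma ballot_number_step:
  fixes d j :: nat
  defines "n \<equiv> d + j"
  assumes G: "(n + 2) * G = (j + 3) * ((n + d) choose (n + 1))"
    and H: "(n + 1) * H = (j + 1) * ((n + d) choose n)"
  shows "(n + 2) * (G + H) = (j + 2) * ((n + d + 1) choose (n + 1))"
proof -
  let ?X = "(n + d) choose (n + 1)" and ?Y = "(n + d) choose n"
  have X: "(n + 1) * ?X = d * ?Y"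
    using binomial_absorb_comp[of "n + d" n] binomial_absorption[of n "n + d"] by simp
  have "(n + 1) * ((n + 2) * (G + H)) = (n + 1) * ((n + 2) * G) + (n + 2) * ((n + 1) * H)"
    by (simp only: algebra_simps)
  also have "\<dots> = (j + 3) * ((n + 1) * ?X) + (n + 2) * (j + 1) * ?Y"
    unfolding G H by (simp only: algebra_simps)
  also have "\<dots> = (j + 2) * (d * ?Y + (n + 1) * ?Y)"
    unfolding X by (simp add: n_def algebra_simps)
  also have "\<dots> = (n + 1) * ((j + 2) * (?X + ?Y))"
    unfolding X[symmetric] by (simp only: algebra_simps)
  finally have "(n + 2) * (G + H) = (j + 2) * (?X + ?Y)"
    using mult_left_cancel[of "n + 1"] by simp
  moreover have "(n + d + 1) choose (n + 1) = ?X + ?Y"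
    by simp
  ultimately show ?thesis
    by (simp only:)
qed

lemma ballot_number_closed_form:
  assumes "1 \<le> d" "d \<le> Suc n"
  shows "(n + 1) * ballot_number n d = (n + 2 - d) * ((n + d - 1) choose n)"
  using assms
proof (induction n arbitrary: d)
  case 0
  then show ?case
    by (simp add: ballot_number_0 le_antisym)
next
  case (Suc n)
  show ?case
    using Suc.prems
  proof (induction d rule: dec_induct)
    case base
    have "(n + 1) * ballot_number n 1 = (n + 1) * 1"
      using Suc.IH[of 1] by simp
    then have "ballot_number n 1 = 1"
      by (simp only: mult_cancel1) simp
    then have "ballot_number (Suc n) 1 = 1"
      by (simp only: ballot_number_first)
    then show ?case
      by simp
  next
    case (step d)
    show ?case
    proof (cases "d \<le> n")
      case True
      then obtain j where n: "n = d + j"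
        using le_Suc_ex by blast
      have "(n + 2) * (ballot_number (Suc n) d + ballot_number n (Suc d))
          = (j + 2) * ((n + d + 1) choose (n + 1))"
        unfolding n
        by (rule ballot_number_step)
           (use step Suc.IH[of "Suc d"] in \<open>simp_all add: n\<close>)
      then show ?thesis
        using ballot_number_Suc_Suc[OF step.hyps(1) True] by (simp add: n)
    next
      case False
      then have d: "d = Suc n"
        using step.prems by simp
      \<comment> \<open>At the boundary both entries count all 321-avoiding permutations, and the
        closed forms agree by the symmetry of the binomial coefficients.\<close>
      have "ballot_number (Suc n) (Suc d) = ballot_number (Suc n) d"
        using d by (simp add: ballot_number_all)
      moreover have "(n + 2) * ballot_number (Suc n) d = 2 * ((2 * n + 1) choose (n + 1))"
        using step.IH by (simp add: d mult_2)
      moreover have "(2 * n + 1) choose n = (2 * n + 1) choose (n + 1)"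
        using binomial_symmetric[of n "2 * n + 1"] by (simp add: mult_2)
      ultimately show ?thesis
        by (simp add: d mult_2)
    qed
  qed
qed

lemma card_avoids_321:
  "(n + 1) * card {w. w permutes {1..n} \<and> avoids_321 w} = (2 * n) choose n"
  using ballot_number_closed_form[of "Suc n" n] by (simp add: ballot_number_all mult_2)

section \<open>Counting permutations avoiding 321 and 3412\<close>

lemma fixed_if_separating:
  fixes u :: "nat \<Rightarrow> nat"
  assumes "bij u" "\<And>z. z < x \<Longrightarrow> u z < u x" "\<And>z. x < z \<Longrightarrow> u x < u z"
  shows "u x = x"
proof -
  have "u ` {..<x} = {..<u x}"
  proof (intro equalityI subsetI)
    fix y assume y: "y \<in> {..<u x}"
    obtain z where z: "y = u z"
      using bij_is_surj[OF assms(1)] by (rule surjE)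
    then have "z < x"
      using y assms(3)[of z] by (cases z x rule: linorder_cases) auto
    then show "y \<in> u ` {..<x}"
      using z by simp
  qed (use assms(2) in auto)
  then have "card {..<u x} = card {..<x}"
    using card_image[OF inj_on_subset[OF bij_is_inj[OF assms(1)] subset_UNIV], of "{..<x}"] by simp
  then show ?thesis
    by simp
qed

definition avoids_both :: "(nat \<Rightarrow> nat) \<Rightarrow> bool" where
  "avoids_both w \<longleftrightarrow> avoids_321 w \<and> avoids_3412 w"

text \<open>Beyond 321, the new danger is n + 1 as the 4 of a 3412. With \<open>u\<close> increasing
  from p on, this occurs exactly when some value left of p exceeds some value right of p; if it does
  not, all positions above p are fixed.\<close>

lemma avoids_both_insert_maximum_iff:
  assumes u: "u permutes {1..n}" and p: "1 \<le> p" "p \<le> n"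
  shows "avoids_both (u \<circ> shift_to p (Suc n)) \<longleftrightarrow> avoids_both u \<and> u permutes {1..p}"
    (is "avoids_both ?w \<longleftrightarrow> _")
proof -
  let ?t = "shift_to p (Suc n)"
  have pS: "p \<le> Suc n"
    using p by simp
  have um: "u (Suc n) = Suc n"
    using permutes_eq_of_gt[OF u] by simp
  have uinj: "u x = u y \<longleftrightarrow> x = y" for x y
    using permutes_inj[OF u] by (simp add: inj_eq)
  have wp: "?w p = Suc n"
    using um by simp
  have ule: "u x \<le> n \<longleftrightarrow> x \<le> n" for x
    by (rule permutes_le_iff[OF u])
  show ?thesis
  proof
    assume "avoids_both ?w"
    then have av321: "avoids_321 ?w" and av: "avoids_3412 ?w"
      by (simp_all add: avoids_both_def)
    have u321: "avoids_321 u" and inc: "strict_mono_on {p..} u"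
      using avoids_321_insert_maximum_iff[OF u p(1) pS] av321 by simp_all
    have no: "\<not> (?w c < ?w d \<and> ?w d < ?w a \<and> ?w a < ?w b)" if "a < b" "b < c" "c < d" for a b c d
      using av that unfolding avoids_3412_def by blast
    have "avoids_3412 u"
      unfolding avoids_3412_def
    proof (intro allI impI notI)
      fix a b c d assume abcd: "a < b" "b < c" "c < d" "u c < u d \<and> u d < u a \<and> u a < u b"
      obtain e where e: "\<And>x. x \<noteq> Suc n \<Longrightarrow> ?t (e x) = x"
          "\<And>x y. x < y \<Longrightarrow> x \<noteq> Suc n \<Longrightarrow> y \<noteq> Suc n \<Longrightarrow> e x < e y"
        using shift_to_section[OF pS] by metis
      have we: "?w (e x) = u x" if "x \<noteq> Suc n" for x
        using e(1)[OF that] by simp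
      have "d \<le> n"
        using permutes_eq_of_gt[OF u, of d] permutes_eq_of_gt[OF u, of a] ule[of a] abcd
        by (cases "a \<le> n"; cases "d \<le> n"; simp)
      then have nm: "a \<noteq> Suc n" "b \<noteq> Suc n" "c \<noteq> Suc n" "d \<noteq> Suc n"
        using abcd by auto
      show False
        using no[OF e(2)[OF abcd(1) nm(1,2)] e(2)[OF abcd(2) nm(2,3)] e(2)[OF abcd(3) nm(3,4)]] abcd(4)
        by (simp only: we[OF nm(1)] we[OF nm(2)] we[OF nm(3)] we[OF nm(4)] simp_thms)
    qed
    moreover have "u x = x" if x: "x \<in> {1..n} - {1..p}" for x
    proof (rule fixed_if_separating[OF permutes_bij[OF u]])
      fix z assume "x < z"
      then show "u x < u z"
        using x by (intro strict_mono_onD[OF inc]) auto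
    next
      fix z assume "z < x"
      show "u z < u x"
      proof (cases "p \<le> z")
        case True
        then show ?thesis
          using x \<open>z < x\<close> by (intro strict_mono_onD[OF inc]) auto
      next
        case False
        have "p < x"
          using x by auto
        have px: "u p < u x"
          using x by (intro strict_mono_onD[OF inc]) auto
        have "?w z = u z" "?w (Suc p) = u p" "?w (Suc x) = u x"
          using False x p by (auto simp: shift_to_def)
        \<comment> \<open>The forbidden 3412 sits at positions z, p, p + 1, x + 1, with n + 1 as its
          4.\<close>
        then have "\<not> (u p < u x \<and> u x < u z \<and> u z < Suc n)"
          using no[of z p "Suc p" "Suc x"] False \<open>p < x\<close> wp by (simp del: o_apply)
        then show ?thesis
          using px uinj[of z x] ule[of z] \<open>z < x\<close> x by (cases "u z" "u x" rule: linorder_cases) auto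
      qed
    qed
    then have "u permutes {1..p}"
      by (rule permutes_superset[OF u])
    ultimately show "avoids_both u \<and> u permutes {1..p}"
      using u321 by (simp add: avoids_both_def)
  next
    assume "avoids_both u \<and> u permutes {1..p}"
    then have u321: "avoids_321 u" and u3412: "avoids_3412 u" and up: "u permutes {1..p}"
      by (simp_all add: avoids_both_def)
    have fixed: "u x = x" if "p < x" for x
      using permutes_eq_of_gt[OF up that] .
    have ulep: "u x \<le> p \<longleftrightarrow> x \<le> p" for x
      by (rule permutes_le_iff[OF up])
    have w_gt: "p < ?w x" if "Suc p < x" for x
    proof -
      have "p < ?t x"
        using that by (auto simp: shift_to_def)
      then show ?thesis
        using fixed by simp
    qed
    have w_lt: "?w x \<le> p" if "x < p" for x
      using that ulep[of x] by (simp add: shift_to_def)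
    have w_max: "?w x \<le> Suc n" if "x \<le> Suc n" for x
      using permutes_le_iff[OF insert_maximum_permutes[OF u p(1) pS]] that by blast
    have w_big: "?w x = x" if "Suc n < x" for x
      using that p fixed[of x] by (simp add: shift_to_def)
    have "avoids_321 ?w"
      using avoids_321_insert_maximum_iff[OF u p(1) pS] u321 strict_mono_on_last[OF up] by simp
    moreover have "avoids_3412 ?w"
      unfolding avoids_3412_def
    proof (intro allI impI notI)
      fix a b c d assume abcd: "a < b" "b < c" "c < d" "?w c < ?w d \<and> ?w d < ?w a \<and> ?w a < ?w b"
      have d: "d \<le> Suc n"
      proof (rule ccontr)
        assume "\<not> d \<le> Suc n"
        then have "?w d = d" "?w a \<le> d"
          using w_big[of d] w_big[of a] w_max[of a] abcd(1-3) by (cases "a \<le> Suc n"; simp del: o_apply)+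
        then show False
          using abcd(4) by simp
      qed
      have "a \<noteq> p" "c \<noteq> p" "d \<noteq> p"
        using wp w_max[of a] w_max[of b] w_max[of d] abcd d by (auto simp del: o_apply)
      moreover have "b \<noteq> p"
        using w_gt[of d] w_lt[of a] abcd by (auto simp del: o_apply)
      ultimately have "?t a < ?t b" "?t b < ?t c" "?t c < ?t d"
        using shift_to_mono abcd(1-3) by simp_all
      then show False
        using u3412 abcd(4) unfolding avoids_3412_def o_apply by blast
    qed
    ultimately show "avoids_both ?w"
      by (simp add: avoids_both_def)
  qed
qed

lemma card_avoids_both_Suc:
  "card {w. w permutes {1..Suc n} \<and> avoids_both w} =
   card {w. w permutes {1..n} \<and> avoids_both w} + (\<Sum>p = 1..n. card {w. w permutes {1..p} \<and> avoids_both w})"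
proof -
  let ?S = "\<lambda>p. {u. u permutes {1..n} \<and> avoids_both (u \<circ> shift_to p (Suc n))}"
  have "?S p = {w. w permutes {1..p} \<and> avoids_both w}" if "p \<in> {1..n}" for p
  proof -
    have sub: "w permutes {1..n}" if "w permutes {1..p}" for w
      using \<open>p \<in> {1..n}\<close> by (intro permutes_subset[OF that]) auto
    then show ?thesis
      using avoids_both_insert_maximum_iff[of _ n p] \<open>p \<in> {1..n}\<close> by (auto dest: sub)
  qed
  then have "(\<Sum>p = 1..n. card (?S p)) = (\<Sum>p = 1..n. card {w. w permutes {1..p} \<and> avoids_both w})"
    by (intro sum.cong) simp_all
  then show ?thesis
    using card_permutations_by_position_of_maximum[of n avoids_both] by simp
qed

lemma avoids_both_id: "avoids_both id"
  by (auto simp: avoids_both_def avoids_3412_def)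

text \<open>The recurrence involves the partial sums, so these are carried through the induction;
  the two sequences interleave to the Fibonacci numbers.\<close>

lemma card_avoids_both:
  "card {w. w permutes {1..Suc n} \<and> avoids_both w} = fib (2 * n + 1) \<and>
   (\<Sum>p = 1..Suc n. card {w. w permutes {1..p} \<and> avoids_both w}) = fib (2 * n + 2)"
proof (induction n)
  case 0
  have "{w. w permutes {1..Suc 0} \<and> avoids_both w} = {id}"
    using avoids_both_id by auto
  then show ?case
    by (simp add: numeral_2_eq_2)
next
  case (Suc n)
  then have "card {w. w permutes {1..Suc (Suc n)} \<and> avoids_both w} = fib (2 * Suc n + 1)"
    using card_avoids_both_Suc[of "Suc n"] by (simp add: add.commute)
  then show ?case
    using Suc by simp
qed

section \<open>Patterns and the main theorem\<close>

lemma permutes_inversionD: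
  assumes "w permutes {1..n::nat}" "a < b" "w b < w a"
  shows "a \<in> {1..n}" "b \<in> {1..n}"
proof -
  show "a \<in> {1..n}"
  proof (rule ccontr)
    assume "a \<notin> {1..n}"
    then have a: "w a = a" "a = 0 \<or> n < a"
      using permutes_not_in[OF assms(1)] by auto
    with assms(2,3) have "n < b"
      by auto
    then show False
      using permutes_eq_of_gt[OF assms(1), of b] a assms(2,3) by simp
  qed
  show "b \<in> {1..n}"
  proof (rule ccontr)
    assume "b \<notin> {1..n}"
    then have "n < b" "w b = b"
      using permutes_not_in[OF assms(1)] assms(2) by auto
    then show False
      using permutes_le_iff[OF assms(1), of a] permutes_eq_of_gt[OF assms(1), of a] assms(2,3)
      by (cases "a \<le> n") auto
  qed
qed

lemma contains_pattern_321_iff: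
  assumes w: "w permutes {1..n}"
  shows "contains_pattern n w [3, 2, 1] \<longleftrightarrow> \<not> avoids_321 w"
proof
  have len: "length [3, 2, 1::nat] = 3"
    by simp
  assume "contains_pattern n w [3, 2, 1]"
  then obtain f where f: "strict_mono_on {..<3} f"
      "\<forall>a < 3. \<forall>b < 3. w (f a) < w (f b) \<longleftrightarrow> [3, 2, 1::nat] ! a < [3, 2, 1] ! b"
    using len unfolding contains_pattern_def by metis
  have "f 0 < f 1" "f 1 < f 2"
    using f(1) by (auto intro: strict_mono_onD)
  moreover have "w (f 2) < w (f 1)" "w (f 1) < w (f 0)"
    using f(2) by simp_all
  ultimately show "\<not> avoids_321 w"
    unfolding avoids_321_def by blast
next
  assume "\<not> avoids_321 w"
  then obtain a b c where abc: "a < b" "b < c" "w c < w b" "w b < w a"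
    unfolding avoids_321_def by blast
  have rng: "a \<in> {1..n}" "b \<in> {1..n}" "c \<in> {1..n}"
    using permutes_inversionD[OF w] abc by blast+
  show "contains_pattern n w [3, 2, 1]"
    unfolding contains_pattern_def
    by (rule exI[of _ "\<lambda>x. [a, b, c] ! x"])
       (use abc rng in \<open>auto simp: strict_mono_on_def less_Suc_eq\<close>)
qed

lemma contains_pattern_3412_iff:
  assumes w: "w permutes {1..n}"
  shows "contains_pattern n w [3, 4, 1, 2] \<longleftrightarrow> \<not> avoids_3412 w"
proof
  have len: "length [3, 4, 1, 2::nat] = 4"
    by simp
  assume "contains_pattern n w [3, 4, 1, 2]"
  then obtain f where f: "strict_mono_on {..<4} f"
      "\<forall>a < 4. \<forall>b < 4. w (f a) < w (f b) \<longleftrightarrow> [3, 4, 1, 2::nat] ! a < [3, 4, 1, 2] ! b"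
    using len unfolding contains_pattern_def by metis
  have "f 0 < f 1" "f 1 < f 2" "f 2 < f 3"
    using f(1) by (auto intro: strict_mono_onD)
  moreover have "w (f 2) < w (f 3)" "w (f 3) < w (f 0)" "w (f 0) < w (f 1)"
    using f(2) by simp_all
  ultimately show "\<not> avoids_3412 w"
    unfolding avoids_3412_def by blast
next
  assume "\<not> avoids_3412 w"
  then obtain a b c d where abcd: "a < b" "b < c" "c < d" "w c < w d" "w d < w a" "w a < w b"
    unfolding avoids_3412_def by blast
  have rng: "a \<in> {1..n}" "b \<in> {1..n}" "c \<in> {1..n}" "d \<in> {1..n}"
    \<comment> \<open>The inversions (a, d) and (b, c) cover all four positions.\<close>
    using permutes_inversionD[OF w, of a d] permutes_inversionD[OF w, of b c] abcd by auto
  show "contains_pattern n w [3, 4, 1, 2]"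
    unfolding contains_pattern_def
    by (rule exI[of _ "\<lambda>x. [a, b, c, d] ! x"])
       (use abcd rng in \<open>auto simp: strict_mono_on_def less_Suc_eq\<close>)
qed

theorem theorem1p4:
  fixes n :: nat
  assumes "n \<ge> 1"
  shows "(\<forall>w. w permutes {1..n} \<longrightarrow>
            (depth n w = coxeter_length n w \<longleftrightarrow> avoids_pattern n w [3, 2, 1]) \<and>
            (reflection_length n w = depth n w \<longleftrightarrow>
               avoids_pattern n w [3, 2, 1] \<and> avoids_pattern n w [3, 4, 1, 2]))
       \<and> real (card {w. w permutes {1..n} \<and> depth n w = coxeter_length n w})
           = 1 / (real n + 1) * real ((2 * n) choose n)
       \<and> card {w. w permutes {1..n} \<and> reflection_length n w = depth n w} = fib (2 * n - 1)"
proof (intro conjI allI impI)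
  have cox: "depth n w = coxeter_length n w \<longleftrightarrow> avoids_321 w" if "w permutes {1..n}" for w
    using coxeter_length_eq_total_crossings_iff[OF that] depth_eq_total_crossings[OF that] by metis
  have refl: "reflection_length n w = depth n w \<longleftrightarrow> avoids_both w" if "w permutes {1..n}" for w
    using reflection_length_eq_total_crossings_iff[OF that] depth_eq_total_crossings[OF that]
    by (simp add: avoids_both_def)
  fix w assume w: "w permutes {1..n}"
  show "depth n w = coxeter_length n w \<longleftrightarrow> avoids_pattern n w [3, 2, 1]"
    using cox[OF w] contains_pattern_321_iff[OF w] by simp
  show "reflection_length n w = depth n w \<longleftrightarrow>
      avoids_pattern n w [3, 2, 1] \<and> avoids_pattern n w [3, 4, 1, 2]"
    using refl[OF w] contains_pattern_321_iff[OF w] contains_pattern_3412_iff[OF w]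
    by (simp add: avoids_both_def)
next
  have "{w. w permutes {1..n} \<and> depth n w = coxeter_length n w} = {w. w permutes {1..n} \<and> avoids_321 w}"
    using coxeter_length_eq_total_crossings_iff[of _ n] depth_eq_total_crossings[of _ n] by (metis (lifting))
  then have "(n + 1) * card {w. w permutes {1..n} \<and> depth n w = coxeter_length n w} = (2 * n) choose n"
    using card_avoids_321[of n] by simp
  then have "(real n + 1) * real (card {w. w permutes {1..n} \<and> depth n w = coxeter_length n w})
      = real ((2 * n) choose n)"
    by (metis of_nat_1 of_nat_add of_nat_mult)
  then show "real (card {w. w permutes {1..n} \<and> depth n w = coxeter_length n w})
      = 1 / (real n + 1) * real ((2 * n) choose n)"
    by (simp add: field_simps)
next
  have "{w. w permutes {1..n} \<and> reflection_length n w = depth n w} = {w. w permutes {1..n} \<and> avoids_both w}"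
    using reflection_length_eq_total_crossings_iff[of _ n] depth_eq_total_crossings[of _ n]
    by (auto simp: avoids_both_def)
  moreover obtain m where "n = Suc m"
    using assms by (cases n) auto
  ultimately show "card {w. w permutes {1..n} \<and> reflection_length n w = depth n w} = fib (2 * n - 1)"
    using card_avoids_both[of m] by simp
qed

end
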